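(* Let $m\ge 1$, and let $\mathcal{B}_2=\{h_{I\times_t J}^{\vec\epsilon}\}_{I,J\in\mathscr{D},\,\vec\epsilon\in\mathcal E\times\mathcal E}$ and $\mathcal{B}_3=\{h_{I\,{}_t\!\times J}^{\vec\epsilon}\}_{I,J\in\mathscr{D},\,\vec\epsilon\in\mathcal E\times\mathcal E}$ be the twisted Haar systems on $\mathbb{R}^{2m}$. Then both $\mathcal{B}_2$ and $\mathcal{B}_3$ satisfy the following properties. (i) The support of each basis function is the corresponding twisted dyadic tube: $\operatorname{supp}(h_{I\times_t J}^{\vec\epsilon})=I\times_t J$ and $\operatorname{supp}(h_{I\,{}_t\!\times J}^{\vec\epsilon})=I\,{}_t\!\times J$, with Lebesgue measures $|I\times_t J|=|I\,{}_t\!\times J|\simeq |I||J|$. (ii) Both $\mathcal{B}_2$ and $\mathcal{B}_3$ are complete orthonormal bases of $L^2(\mathbb{R}^{2m})$. (iii) The elements of $\mathcal{B}_2$ have cancellation in the two variables $u=x_1-x_2$, $v=x_2$, and the elements of $\mathcal{B}_3$ have cancellation in the two variables $u=x_1$, $v=x_2-x_1$. More precisely, for $I,J\in\mathscr D$ and $\vec\epsilon=(\epsilon_1,\epsilon_2)$, $$h_{I\times_t J}^{\vec\epsilon}(x_1,x_2)=h_I^{\epsilon_1}(x_1-x_2)\,h_J^{\epsilon_2}(x_2),\qquad h_{I\,{}_t\!\times J}^{\vec\epsilon}(x_1,x_2)=h_I^{\epsilon_1}(x_1)\,h_J^{\epsilon_2}(x_2-x_1),$$ and, when each function is expressed in its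 respective variables $(u,v)$, its integral vanishes separately in the $u$-variable (for each fixed $v$) and in the $v$-variable (for each fixed $u$).
   Context: $\mathscr{D}$ is the collection of all standard (half-open) dyadic cubes in $\mathbb{R}^m$. For $I=I_1\times\cdots\times I_m\in\mathscr{D}$, $\{h_I^\epsilon\}_{\epsilon\in\mathcal{E}}$, $\mathcal{E}=\{1,\dots,2^m-1\}$, is the standard $L^2$-normalized Haar wavelet basis supported on $I$: the functions $\bigotimes_{i=1}^m h_{I_i}^{a_i}$ with $a\in\{0,1\}^m\setminus\{0\}$, where $h_{K}^0=|K|^{-1/2}\chi_K$ and $h_K^1=|K|^{-1/2}(\chi_{K_{\rm left}}-\chi_{K_{\rm right}})$ for a dyadic interval $K$, enumerated by $\mathcal E$. The support of a Haar function means the set where it is nonzero. Points of $\mathbb R^{2m}$ are written $(x_1,x_2)$ with $x_1,x_2\in\mathbb R^m$. For $I,J\in\mathscr{D}$ and $\vec\epsilon=(\epsilon_1,\epsilon_2)\in\mathcal{E}\times\mathcal{E}$, $h_{I\times J}^{\vec\epsilon}(x_1,x_2)=h_I^{\epsilon_1}(x_1)h_J^{\epsilon_2}(x_2)$. Twisted tubes: $I\times_t J=\{(x_1,x_2)\in\mathbb{R}^{2m}: x_1-x_2\in I,\ x_2\in J\}$ and $I\,{}_t\!\times J=\{(x_1,x_2)\in\mathbb{R}^{2m}: x_1\in I,\ x_2-x_1\in J\}$. Shears: $T_2(x_1,x_2)=(x_1-x_2,x_2)$, $T_3(x_1,x_2)=(x_1,x_2-x_1)$. The twisted Haar functions are $h_{I\times_t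 J}^{\vec\epsilon}=h_{I\times J}^{\vec\epsilon}\circ T_2$ and $h_{I\,{}_t\!\times J}^{\vec\epsilon}=h_{I\times J}^{\vec\epsilon}\circ T_3$. The symbol $\simeq$ denotes comparability up to constants independent of $I,J$. *)

theory Defs
  imports "HOL-Analysis.Analysis"
begin

text \<open>
  Euclidean space of dimension \<open>m\<close> is \<^typ>\<open>real^'m\<close> with \<open>m = CARD('m)\<close>; the space of
  dimension \<open>2m\<close> is \<^typ>\<open>(real^'m) \<times> (real^'m)\<close>.
\<close>

definition dyadic_interval :: "int \<Rightarrow> int \<Rightarrow> real set" where
  "dyadic_interval k j = {of_int j * 2 powi k ..< (of_int j + 1) * 2 powi k}"

definition dyadic_cubes :: "(real^'m) set set" where
  "dyadic_cubes = {{x. \<forall>i. x $ i \<in> dyadic_interval k (j i)} | k j. True}"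

text \<open>The side \<open>I\<^sub>i\<close> of \<open>I = I\<^sub>1 \<times> \<dots> \<times> I\<^sub>m\<close>.\<close>
definition side :: "(real^'m) set \<Rightarrow> 'm \<Rightarrow> real set" where
  "side I i = (\<lambda>x. x $ i) ` I"

definition left_half :: "real set \<Rightarrow> real set" where
  "left_half K = {x \<in> K. x < (Inf K + Sup K) / 2}"

definition right_half :: "real set \<Rightarrow> real set" where
  "right_half K = {x \<in> K. (Inf K + Sup K) / 2 \<le> x}"

text \<open>The superscript \<open>a\<close> takes the values 0 and 1 only.\<close>
definition haar1 :: "nat \<Rightarrow> real set \<Rightarrow> real \<Rightarrow> real" where
  "haar1 a K x = measure lebesgue K powr (-1/2) *
     (if a = 0 then indicator K x else indicator (left_half K) x - indicator (right_half K) x)"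

definition haar_signatures :: "('m \<Rightarrow> nat) set" where
  "haar_signatures = {a. \<forall>i. a i \<in> {0, 1}} - {\<lambda>i. 0}"

definition haar_indices :: "'m::finite itself \<Rightarrow> nat set" where
  "haar_indices _ = {1..2 ^ CARD('m) - 1}"

text \<open>
  No particular enumeration of the signatures by \<open>{1, \<dots>, 2\<^sup>m - 1}\<close> is singled out: the
  definitions below take the enumeration \<open>sig\<close> as a parameter.
\<close>
definition haar_enumeration :: "(nat \<Rightarrow> 'm::finite \<Rightarrow> nat) \<Rightarrow> bool" where
  "haar_enumeration sig \<longleftrightarrow> bij_betw sig (haar_indices TYPE('m)) haar_signatures"

definition haar :: "(nat \<Rightarrow> 'm \<Rightarrow> nat) \<Rightarrow> nat \<Rightarrow> (real^'m) set \<Rightarrow> real^'m \<Rightarrow> real" where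
  "haar sig \<epsilon> I x = (\<Prod>i\<in>UNIV. haar1 (sig \<epsilon> i) (side I i) (x $ i))"

definition haar_prod ::
  "(nat \<Rightarrow> 'm \<Rightarrow> nat) \<Rightarrow> nat \<times> nat \<Rightarrow> (real^'m) set \<Rightarrow> (real^'m) set
    \<Rightarrow> (real^'m) \<times> (real^'m) \<Rightarrow> real" where
  "haar_prod sig \<epsilon> I J = (\<lambda>(x1, x2). haar sig (fst \<epsilon>) I x1 * haar sig (snd \<epsilon>) J x2)"

text \<open>The subscripts 2 and 3 distinguish \<open>I \<times>\<^sub>t J\<close> from \<open>I \<^sub>t\<times> J\<close>.\<close>

definition tube2 :: "'a::ab_group_add set \<Rightarrow> 'a set \<Rightarrow> ('a \<times> 'a) set" where
  "tube2 I J = {(x1, x2). x1 - x2 \<in> I \<and> x2 \<in> J}"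

definition tube3 :: "'a::ab_group_add set \<Rightarrow> 'a set \<Rightarrow> ('a \<times> 'a) set" where
  "tube3 I J = {(x1, x2). x1 \<in> I \<and> x2 - x1 \<in> J}"

definition shear2 :: "'a::ab_group_add \<times> 'a \<Rightarrow> 'a \<times> 'a" where
  "shear2 = (\<lambda>(x1, x2). (x1 - x2, x2))"

definition shear3 :: "'a::ab_group_add \<times> 'a \<Rightarrow> 'a \<times> 'a" where
  "shear3 = (\<lambda>(x1, x2). (x1, x2 - x1))"

definition twisted_haar2 ::
  "(nat \<Rightarrow> 'm \<Rightarrow> nat) \<Rightarrow> nat \<times> nat \<Rightarrow> (real^'m) set \<Rightarrow> (real^'m) set
    \<Rightarrow> (real^'m) \<times> (real^'m) \<Rightarrow> real" where
  "twisted_haar2 sig \<epsilon> I J = haar_prod sig \<epsilon> I J \<circ> shear2"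

definition twisted_haar3 ::
  "(nat \<Rightarrow> 'm \<Rightarrow> nat) \<Rightarrow> nat \<times> nat \<Rightarrow> (real^'m) set \<Rightarrow> (real^'m) set
    \<Rightarrow> (real^'m) \<times> (real^'m) \<Rightarrow> real" where
  "twisted_haar3 sig \<epsilon> I J = haar_prod sig \<epsilon> I J \<circ> shear3"

definition L2 :: "'a measure \<Rightarrow> ('a \<Rightarrow> complex) set" where
  "L2 M = {f \<in> borel_measurable M. integrable M (\<lambda>x. (cmod (f x))\<^sup>2)}"

definition L2_inner :: "'a measure \<Rightarrow> ('a \<Rightarrow> complex) \<Rightarrow> ('a \<Rightarrow> complex) \<Rightarrow> complex" where
  "L2_inner M f g = (LINT x|M. f x * cnj (g x))"

definition L2_norm :: "'a measure \<Rightarrow> ('a \<Rightarrow> complex) \<Rightarrow> real" where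
  "L2_norm M f = sqrt (LINT x|M. (cmod (f x))\<^sup>2)"

text \<open>
  An indexed family \<open>(e i)\<close>, \<open>i \<in> A\<close>, that is orthonormal and whose linear span is dense
  in \<open>L\<^sup>2\<close>. Elements of \<open>L\<^sup>2\<close> are given by representatives; no condition
  distinguishes functions that agree almost everywhere.
\<close>
definition complete_orthonormal_basis :: "'a measure \<Rightarrow> 'i set \<Rightarrow> ('i \<Rightarrow> 'a \<Rightarrow> complex) \<Rightarrow> bool" where
  "complete_orthonormal_basis M A e \<longleftrightarrow>
     (\<forall>i\<in>A. e i \<in> L2 M) \<and>
     (\<forall>i\<in>A. \<forall>j\<in>A. L2_inner M (e i) (e j) = (if i = j then 1 else 0)) \<and>
     (\<forall>f\<in>L2 M. \<forall>r>0. \<exists>F c. finite F \<and> F \<subseteq> A \<and>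
        L2_norm M (\<lambda>x. f x - (\<Sum>i\<in>F. c i * e i x)) < r)"

end

theory Submission imports Defs begin

text \<open>
The shears \<open>(x\<^sub>1, x\<^sub>2) \<mapsto> (x\<^sub>1 - x\<^sub>2, x\<^sub>2)\<close> and \<open>(x\<^sub>1, x\<^sub>2) \<mapsto> (x\<^sub>1, x\<^sub>2 - x\<^sub>1)\<close> are
invertible and preserve Lebesgue measure: each translates one variable by a function of the
other, so Fubini and translation invariance apply (\<open>shear_measure_preserving\<close>). Composition
with such a map is a unitary operator on \<open>L\<^sup>2\<close>, so it carries orthonormal bases to orthonormal
bases (\<open>complete_orthonormal_basis_comp\<close>). A twisted tube is the preimage of \<open>I \<times> J\<close> under a
shear, so it has measure exactly \<open>|I||J|\<close>, and both comparison constants are 1. Supports and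
cancellation are read off from the product formula, one variable at a time. What remains is
that the products \<open>h\<^sub>I \<otimes> h\<^sub>J\<close> form an orthonormal basis of \<open>L\<^sup>2\<close>.

This splits into two facts. The first is that tensor products of orthonormal bases are
orthonormal bases (\<open>complete_orthonormal_basis_tensor\<close>). The second is that the Haar system is
an orthonormal basis of \<open>L\<^sup>2(\<real>\<^sup>m)\<close> (\<open>complete_orthonormal_basis_haar\<close>). Both density
proofs use the same criterion: it suffices to approximate the indicators of a
\<open>\<pi>\<close>-system that generates the \<open>\<sigma>\<close>-algebra, localized to a countable cover by sets
of finite measure (\<open>L2_subset_span_closure_if_pi_system\<close>).

For the Haar system, a wavelet on a cube \<open>Q\<close> is a combination of the indicators of the \<open>2\<^sup>m\<close>
dyadic children of \<open>Q\<close>, with the values of a Walsh character of \<open>{0, 1}\<^sup>m\<close> as coefficients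
(\<open>haar_dyadic_cube\<close>). Orthogonality of the Walsh characters (\<open>walsh_orthogonal\<close>) gives three
things: the mean of a wavelet is 0, wavelets on the same cube are orthonormal, and, by Fourier
inversion, the indicator of a child \<open>Q'\<close> equals \<open>2\<^sup>-\<^sup>m 1\<^sub>Q\<close> plus a combination of wavelets on
\<open>Q\<close>. Iterating the last identity along the ancestors of a cube \<open>R\<close> leaves, after \<open>n\<close> steps, the
remainder \<open>2\<^sup>-\<^sup>m\<^sup>n 1\<^sub>P\<close> with \<open>|P| = 2\<^sup>m\<^sup>n |R|\<close>, whose squared norm \<open>2\<^sup>-\<^sup>m\<^sup>n |R|\<close> tends to 0; hence
every dyadic indicator lies in the closed span. Wavelets on different cubes are orthogonal
because dyadic cubes are nested or disjoint, and a wavelet is constant on every strictly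
smaller dyadic cube.

Everything is done for Borel sets and \<open>lborel\<close>, because \<open>lborel\<close> on \<open>\<real>\<^sup>2\<^sup>m\<close> is a product measure
and its completion is not a product of completions; the completion comes in at the end
(\<open>complete_orthonormal_basis_completion\<close>).
\<close>

section \<open>Square-integrable functions and closed spans\<close>

lemma ennreal_mult_arbitrarily_small:
  fixes u :: ennreal
  assumes "u < \<infinity>" "r > 0"
  obtains s where "s > 0" "\<And>t. t < ennreal s \<Longrightarrow> u * t < ennreal r"
proof -
  obtain a where a: "u = ennreal a" "a \<ge> 0" using assms(1) by (cases u) auto
  have "u * t < ennreal r" if "t < ennreal (r / (a + 1))" for t
  proof -
    obtain b where b: "t = ennreal b" "b \<ge> 0" using \<open>t < _\<close> by (cases t) auto
    have "b < r / (a + 1)" using that b by (simp add: ennreal_less_iff)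
    then have "a * b + b < r" using a by (simp add: field_simps)
    then show ?thesis
      using a b assms(2) by (simp add: ennreal_mult[symmetric] ennreal_less_iff)
  qed
  moreover have "r / (a + 1) > 0" using a assms(2) by simp
  ultimately show ?thesis by (rule that[rotated])
qed

text \<open>
The squared norm as an extended nonnegative integral: it is infinite for measurable functions
outside \<open>L\<^sup>2\<close>, where a Bochner integral would be 0, so estimates need only measurability.
\<close>
definition L2_sq :: "'a measure \<Rightarrow> ('a \<Rightarrow> complex) \<Rightarrow> ennreal" where
  "L2_sq M f = (\<integral>\<^sup>+x. ennreal ((cmod (f x))\<^sup>2) \<partial>M)"

lemma L2_iff_L2_sq_finite: "f \<in> L2 M \<longleftrightarrow> f \<in> borel_measurable M \<and> L2_sq M f < \<infinity>"
  by (auto simp: L2_def L2_sq_def integrable_iff_bounded)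

lemma L2_sq_eq_L2_norm: "f \<in> L2 M \<Longrightarrow> L2_sq M f = ennreal ((L2_norm M f)\<^sup>2)"
  unfolding L2_def L2_sq_def L2_norm_def by (simp add: nn_integral_eq_integral)

lemma L2_norm_less_iff:
  assumes "f \<in> L2 M" "r > 0"
  shows "L2_norm M f < r \<longleftrightarrow> L2_sq M f < ennreal (r\<^sup>2)"
proof -
  have "L2_norm M f \<ge> 0" by (simp add: L2_norm_def)
  then have "L2_norm M f < r \<longleftrightarrow> (L2_norm M f)\<^sup>2 < r\<^sup>2"
    using assms(2) by (auto intro: power_strict_mono power2_less_imp_less)
  then show ?thesis
    by (simp add: L2_sq_eq_L2_norm[OF assms(1)] ennreal_less_iff)
qed

lemma L2_sq_cong: "(\<And>x. x \<in> space M \<Longrightarrow> f x = g x) \<Longrightarrow> L2_sq M f = L2_sq M g"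
  unfolding L2_sq_def by (intro nn_integral_cong) auto

lemma L2_sq_cmult:
  assumes "f \<in> borel_measurable M"
  shows "L2_sq M (\<lambda>x. c * f x) = ennreal ((cmod c)\<^sup>2) * L2_sq M f"
  unfolding L2_sq_def using assms
  by (subst nn_integral_cmult[symmetric]) (auto simp: norm_mult power_mult_distrib ennreal_mult)

lemma cmod_add_sq_le: "(cmod (a + b))\<^sup>2 \<le> 2 * (cmod a)\<^sup>2 + 2 * (cmod b)\<^sup>2"
proof -
  have "(cmod (a + b))\<^sup>2 \<le> (cmod a + cmod b)\<^sup>2"
    by (intro power_mono norm_triangle_ineq) auto
  also have "\<dots> \<le> 2 * (cmod a)\<^sup>2 + 2 * (cmod b)\<^sup>2"
    using zero_le_power2[of "cmod a - cmod b"] by (simp add: power2_eq_square algebra_simps)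
  finally show ?thesis .
qed

text \<open>
This bound replaces Minkowski's inequality: the factor 2 is harmless for approximation, and
the pointwise inequality integrates directly.
\<close>
lemma L2_sq_add_le:
  assumes [measurable]: "f \<in> borel_measurable M" "g \<in> borel_measurable M"
  shows "L2_sq M (\<lambda>x. f x + g x) \<le> 2 * L2_sq M f + 2 * L2_sq M g"
proof -
  have "L2_sq M (\<lambda>x. f x + g x)
      \<le> (\<integral>\<^sup>+x. 2 * ennreal ((cmod (f x))\<^sup>2) + 2 * ennreal ((cmod (g x))\<^sup>2) \<partial>M)"
    unfolding L2_sq_def
  proof (intro nn_integral_mono)
    fix x
    have "ennreal ((cmod (f x + g x))\<^sup>2) \<le> ennreal (2 * (cmod (f x))\<^sup>2 + 2 * (cmod (g x))\<^sup>2)"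
      by (intro ennreal_leI cmod_add_sq_le)
    then show "ennreal ((cmod (f x + g x))\<^sup>2)
        \<le> 2 * ennreal ((cmod (f x))\<^sup>2) + 2 * ennreal ((cmod (g x))\<^sup>2)"
      by (simp add: ennreal_plus ennreal_mult)
  qed
  also have "\<dots> = 2 * L2_sq M f + 2 * L2_sq M g"
    unfolding L2_sq_def by (subst nn_integral_add) (auto simp: nn_integral_cmult)
  finally show ?thesis .
qed

lemma L2_sq_add_less:
  assumes "f \<in> borel_measurable M" "g \<in> borel_measurable M"
    and "L2_sq M f < ennreal (r / 4)" "L2_sq M g < ennreal (r / 4)"
  shows "L2_sq M (\<lambda>x. f x + g x) < ennreal r"
proof -
  have r: "r > 0" using assms(3) by (cases "r \<le> 0") (auto simp: ennreal_neg)
  obtain a where a: "L2_sq M f = ennreal a" "a \<ge> 0" using assms(3) by (cases "L2_sq M f") auto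
  obtain b where b: "L2_sq M g = ennreal b" "b \<ge> 0" using assms(4) by (cases "L2_sq M g") auto
  have "2 * L2_sq M f + 2 * L2_sq M g = ennreal (2 * a + 2 * b)"
    using a b by (simp add: ennreal_plus ennreal_mult)
  also have "\<dots> < ennreal r"
    using a b assms(3,4) r by (simp add: ennreal_less_iff del: ennreal_plus)
  finally show ?thesis using L2_sq_add_le[OF assms(1,2)] by (rule le_less_trans[rotated])
qed

lemma L2_add: "f \<in> L2 M \<Longrightarrow> g \<in> L2 M \<Longrightarrow> (\<lambda>x. f x + g x) \<in> L2 M"
  using le_less_trans[OF L2_sq_add_le[of f M g], of \<infinity>]
  by (auto simp: L2_iff_L2_sq_finite ennreal_mult_less_top)

lemma L2_cmult: "f \<in> L2 M \<Longrightarrow> (\<lambda>x. c * f x) \<in> L2 M"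
  by (auto simp: L2_iff_L2_sq_finite L2_sq_cmult ennreal_mult_less_top)

lemma L2_zero: "(\<lambda>x. 0) \<in> L2 M"
  by (simp add: L2_iff_L2_sq_finite L2_sq_def)

lemma L2_sum: "(\<And>i. i \<in> F \<Longrightarrow> f i \<in> L2 M) \<Longrightarrow> (\<lambda>x. \<Sum>i\<in>F. f i x) \<in> L2 M"
  by (induction F rule: infinite_finite_induct) (auto simp: L2_zero intro: L2_add)

lemma L2_diff: "f \<in> L2 M \<Longrightarrow> g \<in> L2 M \<Longrightarrow> (\<lambda>x. f x - g x) \<in> L2 M"
  using L2_add[of f M "\<lambda>x. (-1) * g x"] L2_cmult[of g M "-1"] by simp

lemma integrable_L2_mult_cnj:
  assumes "f \<in> L2 M" "g \<in> L2 M"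
  shows "integrable M (\<lambda>x. f x * cnj (g x))"
proof (rule Bochner_Integration.integrable_bound)
  show "integrable M (\<lambda>x. (cmod (f x))\<^sup>2 + (cmod (g x))\<^sup>2)" using assms by (auto simp: L2_def)
  have "(\<lambda>x. cnj (g x)) \<in> borel_measurable M"
    using assms by (intro borel_measurable_continuous_on[of cnj]) (auto simp: L2_def intro!: continuous_intros)
  then show "(\<lambda>x. f x * cnj (g x)) \<in> borel_measurable M" using assms by (auto simp: L2_def)
  have "a * b \<le> a\<^sup>2 + b\<^sup>2" for a b :: real
    using zero_le_power2[of "a - b"] zero_le_power2[of "a + b"]
    by (simp add: power2_diff power2_sum)
  then show "AE x in M. cmod (f x * cnj (g x)) \<le> norm ((cmod (f x))\<^sup>2 + (cmod (g x))\<^sup>2)"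
    by (simp add: norm_mult)
qed

lemma L2_indicator:
  assumes "E \<in> sets M" "emeasure M E < \<infinity>"
  shows "(indicator E :: _ \<Rightarrow> complex) \<in> L2 M"
proof -
  have "L2_sq M (indicator E) = (\<integral>\<^sup>+x. indicator E x \<partial>M)"
    unfolding L2_sq_def by (intro nn_integral_cong) (auto simp: indicator_def)
  then show ?thesis using assms by (simp add: L2_iff_L2_sq_finite)
qed

definition L2_span_closure :: "'a measure \<Rightarrow> 'i set \<Rightarrow> ('i \<Rightarrow> 'a \<Rightarrow> complex) \<Rightarrow> ('a \<Rightarrow> complex) set" where
  "L2_span_closure M A e = {f \<in> borel_measurable M. \<forall>r>0. \<exists>F c. finite F \<and> F \<subseteq> A \<and>
     L2_sq M (\<lambda>x. f x - (\<Sum>i\<in>F. c i * e i x)) < ennreal r}"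

text \<open>
Completeness restated with \<^const>\<open>L2_sq\<close> in place of the norm, as the form in which all density
arguments below are carried out.
\<close>
lemma complete_orthonormal_basis_iff:
  "complete_orthonormal_basis M A e \<longleftrightarrow>
     (\<forall>i\<in>A. e i \<in> L2 M) \<and>
     (\<forall>i\<in>A. \<forall>j\<in>A. L2_inner M (e i) (e j) = (if i = j then 1 else 0)) \<and>
     L2 M \<subseteq> L2_span_closure M A e"
proof (cases "\<forall>i\<in>A. e i \<in> L2 M")
  case True
  have iff: "L2_norm M (\<lambda>x. f x - (\<Sum>i\<in>F. c i * e i x)) < r \<longleftrightarrow>
      L2_sq M (\<lambda>x. f x - (\<Sum>i\<in>F. c i * e i x)) < ennreal (r\<^sup>2)"
    if "f \<in> L2 M" "F \<subseteq> A" "r > 0" for f F c and r :: real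
    using that True by (intro L2_norm_less_iff L2_diff L2_sum L2_cmult) auto
  have "(\<forall>r>0. \<exists>F c. finite F \<and> F \<subseteq> A \<and> L2_norm M (\<lambda>x. f x - (\<Sum>i\<in>F. c i * e i x)) < r)
      \<longleftrightarrow> f \<in> L2_span_closure M A e" (is "?L \<longleftrightarrow> ?R") if f: "f \<in> L2 M" for f
  proof
    assume L: ?L
    show ?R unfolding L2_span_closure_def
    proof (safe)
      show "f \<in> borel_measurable M" using f by (simp add: L2_def)
      fix r :: real assume r: "r > 0"
      then have "sqrt r > 0" by simp
      then obtain F c where "finite F" "F \<subseteq> A" "L2_norm M (\<lambda>x. f x - (\<Sum>i\<in>F. c i * e i x)) < sqrt r"
        using L by blast
      then show "\<exists>F c. finite F \<and> F \<subseteq> A \<and> L2_sq M (\<lambda>x. f x - (\<Sum>i\<in>F. c i * e i x)) < ennreal r"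
        using iff[of f F "sqrt r" c] f r by auto
    qed
  next
    assume R: ?R
    show ?L
    proof (intro allI impI)
      fix r :: real assume r: "r > 0"
      then have "r\<^sup>2 > 0" by simp
      then obtain F c where "finite F" "F \<subseteq> A"
          "L2_sq M (\<lambda>x. f x - (\<Sum>i\<in>F. c i * e i x)) < ennreal (r\<^sup>2)"
        using R unfolding L2_span_closure_def by blast
      then show "\<exists>F c. finite F \<and> F \<subseteq> A \<and> L2_norm M (\<lambda>x. f x - (\<Sum>i\<in>F. c i * e i x)) < r"
        using iff[of f F r c] f r by auto
    qed
  qed
  then show ?thesis unfolding complete_orthonormal_basis_def by blast
qed (auto simp: complete_orthonormal_basis_def)

lemma span_closure_measurable: "f \<in> L2_span_closure M A e \<Longrightarrow> f \<in> borel_measurable M"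
  by (simp add: L2_span_closure_def)

context
  fixes M :: "'a measure" and A :: "'i set" and e :: "'i \<Rightarrow> 'a \<Rightarrow> complex"
  assumes meas_e: "\<And>i. i \<in> A \<Longrightarrow> e i \<in> borel_measurable M"
begin

lemma span_measurable: "F \<subseteq> A \<Longrightarrow> (\<lambda>x. \<Sum>i\<in>F. c i * e i x) \<in> borel_measurable M"
  by (intro borel_measurable_sum borel_measurable_times) (auto intro: meas_e)

lemma span_closure_span:
  assumes "finite F" "F \<subseteq> A"
  shows "(\<lambda>x. \<Sum>i\<in>F. c i * e i x) \<in> L2_span_closure M A e"
  unfolding L2_span_closure_def
proof safe
  fix r :: real assume "r > 0"
  then show "\<exists>G d. finite G \<and> G \<subseteq> A \<and>
      L2_sq M (\<lambda>x. (\<Sum>i\<in>F. c i * e i x) - (\<Sum>i\<in>G. d i * e i x)) < ennreal r"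
    using assms by (intro exI[of _ F] exI[of _ c]) (simp add: L2_sq_def)
qed (use assms span_measurable in auto)

lemma span_closure_basis: "i \<in> A \<Longrightarrow> e i \<in> L2_span_closure M A e"
  using span_closure_span[of "{i}" "\<lambda>_. 1"] by simp

lemma span_closure_zero: "(\<lambda>x. 0) \<in> L2_span_closure M A e"
  using span_closure_span[of "{}"] by simp

lemma span_closure_add:
  assumes f: "f \<in> L2_span_closure M A e" and g: "g \<in> L2_span_closure M A e"
  shows "(\<lambda>x. f x + g x) \<in> L2_span_closure M A e"
  unfolding L2_span_closure_def
proof safe
  show "(\<lambda>x. f x + g x) \<in> borel_measurable M"
    using f g by (intro borel_measurable_add span_closure_measurable)
  fix r :: real assume "r > 0"
  then have r: "r / 4 > 0" by simp
  obtain F c where F: "finite F" "F \<subseteq> A" "L2_sq M (\<lambda>x. f x - (\<Sum>i\<in>F. c i * e i x)) < ennreal (r / 4)"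
    using f r unfolding L2_span_closure_def by blast
  obtain G d where G: "finite G" "G \<subseteq> A" "L2_sq M (\<lambda>x. g x - (\<Sum>i\<in>G. d i * e i x)) < ennreal (r / 4)"
    using g r unfolding L2_span_closure_def by blast
  \<comment> \<open>The index sets may overlap, so coefficients are extended by 0 and added on the union.\<close>
  define b where "b i = (if i \<in> F then c i else 0) + (if i \<in> G then d i else 0)" for i
  have eq: "(\<Sum>i\<in>F \<union> G. b i * e i x) = (\<Sum>i\<in>F. c i * e i x) + (\<Sum>i\<in>G. d i * e i x)" for x
  proof -
    have "(\<Sum>i\<in>F \<union> G. b i * e i x) =
        (\<Sum>i\<in>F \<union> G. if i \<in> F then c i * e i x else 0) + (\<Sum>i\<in>F \<union> G. if i \<in> G then d i * e i x else 0)"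
      unfolding sum.distrib[symmetric] b_def by (intro sum.cong) (auto simp: algebra_simps)
    also have "\<dots> = (\<Sum>i\<in>F. c i * e i x) + (\<Sum>i\<in>G. d i * e i x)"
      using F G by (simp add: sum.inter_restrict[symmetric] Int_absorb1 Int_absorb2)
    finally show ?thesis .
  qed
  have "L2_sq M (\<lambda>x. (f x - (\<Sum>i\<in>F. c i * e i x)) + (g x - (\<Sum>i\<in>G. d i * e i x))) < ennreal r"
    using F G f g span_measurable span_closure_measurable
    by (intro L2_sq_add_less borel_measurable_diff) auto
  then have "L2_sq M (\<lambda>x. f x + g x - (\<Sum>i\<in>F \<union> G. b i * e i x)) < ennreal r"
    by (simp add: eq algebra_simps)
  then show "\<exists>F c. finite F \<and> F \<subseteq> A \<and> L2_sq M (\<lambda>x. f x + g x - (\<Sum>i\<in>F. c i * e i x)) < ennreal r"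
    using F G by (intro exI[of _ "F \<union> G"] exI[of _ b]) auto
qed

lemma span_closure_cmult:
  assumes f: "f \<in> L2_span_closure M A e"
  shows "(\<lambda>x. a * f x) \<in> L2_span_closure M A e"
  unfolding L2_span_closure_def
proof safe
  show "(\<lambda>x. a * f x) \<in> borel_measurable M" using f by (auto dest: span_closure_measurable)
  fix r :: real assume "r > 0"
  moreover have "ennreal ((cmod a)\<^sup>2) < \<infinity>" by simp
  ultimately obtain s where s: "s > 0" "\<And>t. t < ennreal s \<Longrightarrow> ennreal ((cmod a)\<^sup>2) * t < ennreal r"
    using ennreal_mult_arbitrarily_small by blast
  obtain F c where F: "finite F" "F \<subseteq> A" "L2_sq M (\<lambda>x. f x - (\<Sum>i\<in>F. c i * e i x)) < ennreal s"
    using f s(1) unfolding L2_span_closure_def by blast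
  have "L2_sq M (\<lambda>x. a * (f x - (\<Sum>i\<in>F. c i * e i x))) < ennreal r"
    using s(2)[OF F(3)] span_closure_measurable[OF f] span_measurable[OF F(2)]
    by (subst L2_sq_cmult) auto
  then have "L2_sq M (\<lambda>x. a * f x - (\<Sum>i\<in>F. (a * c i) * e i x)) < ennreal r"
    by (simp add: right_diff_distrib sum_distrib_left mult.assoc)
  then show "\<exists>F c. finite F \<and> F \<subseteq> A \<and> L2_sq M (\<lambda>x. a * f x - (\<Sum>i\<in>F. c i * e i x)) < ennreal r"
    using F by (intro exI[of _ F] exI[of _ "\<lambda>i. a * c i"]) auto
qed

lemma span_closure_diff:
  assumes "f \<in> L2_span_closure M A e" "g \<in> L2_span_closure M A e"
  shows "(\<lambda>x. f x - g x) \<in> L2_span_closure M A e"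
  using span_closure_add[OF assms(1) span_closure_cmult[OF assms(2), of "-1"]] by simp

lemma span_closure_sum:
  assumes "\<And>i. i \<in> F \<Longrightarrow> f i \<in> L2_span_closure M A e"
  shows "(\<lambda>x. \<Sum>i\<in>F. f i x) \<in> L2_span_closure M A e"
  using assms
  by (induction F rule: infinite_finite_induct) (auto simp: span_closure_zero intro: span_closure_add)

lemma span_closure_closed:
  assumes f: "f \<in> borel_measurable M"
    and near: "\<And>r. r > 0 \<Longrightarrow> \<exists>g\<in>L2_span_closure M A e. L2_sq M (\<lambda>x. f x - g x) < ennreal r"
  shows "f \<in> L2_span_closure M A e"
  unfolding L2_span_closure_def
proof safe
  fix r :: real assume "r > 0"
  then have r: "r / 4 > 0" by simp
  obtain g where g: "g \<in> L2_span_closure M A e" "L2_sq M (\<lambda>x. f x - g x) < ennreal (r / 4)"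
    using near[OF r] by blast
  obtain F c where F: "finite F" "F \<subseteq> A" "L2_sq M (\<lambda>x. g x - (\<Sum>i\<in>F. c i * e i x)) < ennreal (r / 4)"
    using g r unfolding L2_span_closure_def by blast
  have "L2_sq M (\<lambda>x. (f x - g x) + (g x - (\<Sum>i\<in>F. c i * e i x))) < ennreal r"
    using F g f span_measurable span_closure_measurable
    by (intro L2_sq_add_less borel_measurable_diff) auto
  then show "\<exists>F c. finite F \<and> F \<subseteq> A \<and> L2_sq M (\<lambda>x. f x - (\<Sum>i\<in>F. c i * e i x)) < ennreal r"
    using F by (intro exI[of _ F] exI[of _ c]) auto
qed (use f in auto)

text \<open>
The bound by a multiple of the limit covers both uses: partial sums of disjoint indicators,
and simple functions approximating an \<open>L\<^sup>2\<close> function.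
\<close>
lemma span_closure_dominated_limit:
  assumes f: "f \<in> L2 M" and g: "\<And>n. g n \<in> L2_span_closure M A e"
    and lim: "\<And>x. x \<in> space M \<Longrightarrow> (\<lambda>n. g n x) \<longlonglongrightarrow> f x"
    and bound: "\<And>n x. x \<in> space M \<Longrightarrow> cmod (f x - g n x) \<le> K * cmod (f x)"
  shows "f \<in> L2_span_closure M A e"
proof (rule span_closure_closed)
  show f': "f \<in> borel_measurable M" using f by (simp add: L2_def)
  have "(\<lambda>n. L2_sq M (\<lambda>x. f x - g n x)) \<longlonglongrightarrow> (\<integral>\<^sup>+x. 0 \<partial>M)"
    unfolding L2_sq_def
  proof (rule nn_integral_dominated_convergence)
    show "(\<lambda>x. ennreal ((cmod (f x - g n x))\<^sup>2)) \<in> borel_measurable M" for n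
      using f' span_closure_measurable[OF g[of n]] by measurable
    show "(\<lambda>x. ennreal (K\<^sup>2) * ennreal ((cmod (f x))\<^sup>2)) \<in> borel_measurable M"
      using f' by measurable
    show "(\<integral>\<^sup>+x. ennreal (K\<^sup>2) * ennreal ((cmod (f x))\<^sup>2) \<partial>M) < \<infinity>"
      using f f' by (simp add: nn_integral_cmult L2_iff_L2_sq_finite L2_sq_def ennreal_mult_less_top)
    show "AE x in M. ennreal ((cmod (f x - g n x))\<^sup>2) \<le> ennreal (K\<^sup>2) * ennreal ((cmod (f x))\<^sup>2)" for n
    proof (rule AE_I2)
      fix x assume "x \<in> space M"
      then have "(cmod (f x - g n x))\<^sup>2 \<le> (K * cmod (f x))\<^sup>2"
        by (intro power_mono bound) auto
      then show "ennreal ((cmod (f x - g n x))\<^sup>2) \<le> ennreal (K\<^sup>2) * ennreal ((cmod (f x))\<^sup>2)"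
        by (simp add: ennreal_mult[symmetric] power_mult_distrib ennreal_leI)
    qed
    show "AE x in M. (\<lambda>n. ennreal ((cmod (f x - g n x))\<^sup>2)) \<longlonglongrightarrow> 0"
    proof (rule AE_I2)
      fix x assume "x \<in> space M"
      then have "(\<lambda>n. ennreal ((cmod (f x - g n x))\<^sup>2)) \<longlonglongrightarrow> ennreal ((cmod (f x - f x))\<^sup>2)"
        by (intro tendsto_intros lim tendsto_ennrealI)
      then show "(\<lambda>n. ennreal ((cmod (f x - g n x))\<^sup>2)) \<longlonglongrightarrow> 0" by simp
    qed
  qed auto
  then have "(\<lambda>n. L2_sq M (\<lambda>x. f x - g n x)) \<longlonglongrightarrow> 0" by simp
  moreover fix r :: real assume "r > 0"
  ultimately have "\<forall>\<^sub>F n in sequentially. L2_sq M (\<lambda>x. f x - g n x) < ennreal r"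
    by (intro order_tendstoD) auto
  then obtain n where "L2_sq M (\<lambda>x. f x - g n x) < ennreal r"
    by (auto simp: eventually_sequentially)
  then show "\<exists>g\<in>L2_span_closure M A e. L2_sq M (\<lambda>x. f x - g x) < ennreal r"
    using g by blast
qed

section \<open>Density from indicator functions\<close>

lemma span_closure_indicator_UN:
  fixes E :: "nat \<Rightarrow> 'a set"
  assumes disj: "disjoint_family E" and E: "\<And>n. indicator (E n) \<in> L2_span_closure M A e"
    and sets: "\<And>n. E n \<in> sets M" and fin: "emeasure M (\<Union>n. E n) < \<infinity>"
  shows "indicator (\<Union>n. E n) \<in> L2_span_closure M A e"
proof (rule span_closure_dominated_limit[where g="\<lambda>n x. \<Sum>i<n. indicator (E i) x" and K=1])
  show "indicator (\<Union>n. E n) \<in> L2 M" using sets fin by (intro L2_indicator) auto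
  show "(\<lambda>x. \<Sum>i<n. indicator (E i) x) \<in> L2_span_closure M A e" for n
    using E by (intro span_closure_sum)
  have eq: "(\<Sum>i<n. indicator (E i) x) = (indicator (\<Union>i<n. E i) x :: complex)" for n x
    using disj by (intro indicator_UN_disjoint[symmetric]) (auto simp: disjoint_family_on_def)
  show "(\<lambda>n. \<Sum>i<n. indicator (E i) x) \<longlonglongrightarrow> (indicator (\<Union>n. E n) x :: complex)" for x
    unfolding eq by (rule LIMSEQ_indicator_UN)
  show "cmod (indicator (\<Union>n. E n) x - (\<Sum>i<n. indicator (E i) x)) \<le> 1 * cmod (indicator (\<Union>n. E n) x)"
    for n x
    unfolding eq by (auto simp: indicator_def)
qed

text \<open>
Every \<open>f\<close> in \<open>L\<^sup>2\<close> is a limit of simple functions \<open>s\<close> with \<open>|s| \<le> 2|f|\<close>. By Chebyshev, the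
level sets of \<open>s\<close> for nonzero values have finite measure, so \<open>s\<close> is a combination of
admissible indicators.
\<close>
lemma L2_subset_span_closure_if_indicators:
  assumes ind: "\<And>E. E \<in> sets M \<Longrightarrow> emeasure M E < \<infinity> \<Longrightarrow> indicator E \<in> L2_span_closure M A e"
  shows "L2 M \<subseteq> L2_span_closure M A e"
proof
  fix f assume f: "f \<in> L2 M"
  then have f': "f \<in> borel_measurable M" by (simp add: L2_def)
  obtain s where s: "\<And>n. simple_function M (s n)"
    and lim: "\<And>x. x \<in> space M \<Longrightarrow> (\<lambda>n. s n x) \<longlonglongrightarrow> f x"
    and bound: "\<And>n x. x \<in> space M \<Longrightarrow> dist (s n x) 0 \<le> 2 * dist (f x) 0"
    using borel_measurable_implies_sequence_metric[OF f', of 0] by blast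
  show "f \<in> L2_span_closure M A e"
  proof (rule span_closure_dominated_limit[OF f _ lim])
    show "cmod (f x - s n x) \<le> 3 * cmod (f x)" if "x \<in> space M" for n x
      using bound[OF that, of n] norm_triangle_ineq4[of "f x" "s n x"] by simp
    fix n
    let ?E = "\<lambda>y. s n -` {y} \<inter> space M"
    have s_meas: "s n \<in> borel_measurable M" using s by (rule borel_measurable_simple_function)
    have E: "?E y \<in> sets M" for y using s_meas by measurable
    have s_L2: "L2_sq M (s n) < \<infinity>"
    proof -
      have "L2_sq M (s n) \<le> L2_sq M (\<lambda>x. 2 * f x)"
        unfolding L2_sq_def using bound[of _ n]
        by (intro nn_integral_mono ennreal_leI power_mono) (auto simp: norm_mult)
      also have "\<dots> < \<infinity>" using L2_cmult[OF f, of 2] by (simp add: L2_iff_L2_sq_finite)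
      finally show ?thesis .
    qed
    have fin: "emeasure M (?E y) < \<infinity>" if "y \<noteq> 0" for y
    proof -
      have "ennreal ((cmod y)\<^sup>2) * emeasure M (?E y) = (\<integral>\<^sup>+x. ennreal ((cmod y)\<^sup>2) * indicator (?E y) x \<partial>M)"
        using E by (simp add: nn_integral_cmult_indicator)
      also have "\<dots> \<le> L2_sq M (s n)"
        unfolding L2_sq_def by (intro nn_integral_mono) (auto simp: indicator_def)
      finally have "ennreal ((cmod y)\<^sup>2) * emeasure M (?E y) < \<infinity>" using s_L2 by simp
      then show ?thesis using that by (auto simp: ennreal_mult_less_top)
    qed
    have "(\<lambda>x. \<Sum>y\<in>s n ` space M - {0}. y * indicator (?E y) x) \<in> L2_span_closure M A e"
      using E fin by (intro span_closure_sum span_closure_cmult ind) auto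
    moreover have "(\<Sum>y\<in>s n ` space M - {0}. y * indicator (?E y) x) = s n x" if "x \<in> space M" for x
    proof -
      have "(\<Sum>y\<in>s n ` space M - {0}. y * indicator (?E y) x) =
          (\<Sum>y\<in>s n ` space M - {0}. if y = s n x then y else 0)"
        using that by (intro sum.cong) (auto simp: indicator_def)
      then show ?thesis using that s[of n] by (auto simp: simple_function_def)
    qed
    ultimately show "s n \<in> L2_span_closure M A e"
      unfolding L2_span_closure_def using s_meas
      by (auto cong: L2_sq_cong)
  qed
qed

text \<open>
For fixed \<open>n\<close>, the sets \<open>E\<close> for which the indicator of \<open>E \<inter> B n\<close> is in the closure form a Dynkin
system: a complement is a difference of two indicators, and a disjoint union stays inside
\<open>B n\<close>, hence has finite measure. So this class is the whole \<open>\<sigma>\<close>-algebra. A set of finite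
measure is then cut into disjoint pieces, each contained in one \<open>B n\<close>.
\<close>
lemma L2_subset_span_closure_if_pi_system:
  fixes B :: "nat \<Rightarrow> 'a set"
  assumes G: "Int_stable G" "G \<subseteq> Pow (space M)" "sets M = sigma_sets (space M) G"
    and cover: "(\<Union>n. B n) = space M"
    and B: "\<And>n. B n \<in> sets M" "\<And>n. emeasure M (B n) < \<infinity>"
       "\<And>n. indicator (B n) \<in> L2_span_closure M A e"
    and GB: "\<And>E n. E \<in> G \<Longrightarrow> indicator (E \<inter> B n) \<in> L2_span_closure M A e"
  shows "L2 M \<subseteq> L2_span_closure M A e"
proof (rule L2_subset_span_closure_if_indicators)
  have local: "indicator (E \<inter> B n) \<in> L2_span_closure M A e" if "E \<in> sets M" for E n
    using G(1,2) that[unfolded G(3)]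
  proof (induction E rule: sigma_sets_induct_disjoint)
    case (basic E)
    then show ?case by (rule GB)
  next
    case empty
    then show ?case using span_closure_zero by (simp add: indicator_def[abs_def])
  next
    case (compl E)
    have "E \<in> sets M" using compl(1) G(3) by simp
    have "B n \<subseteq> space M" using B(1) by (rule sets.sets_into_space)
    then have "indicator ((space M - E) \<inter> B n) = (\<lambda>x. indicator (B n) x - indicator (E \<inter> B n) x :: complex)"
      by (auto simp: indicator_def fun_eq_iff)
    then show ?case using span_closure_diff[OF B(3)[of n] compl(2)] by simp
  next
    case (union E)
    have E: "E i \<in> sets M" for i using union(2) G(3) by auto
    have "indicator (\<Union>i. E i \<inter> B n) \<in> L2_span_closure M A e"
    proof (rule span_closure_indicator_UN)
      show "disjoint_family (\<lambda>i. E i \<inter> B n)"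
        using union(1) by (auto simp: disjoint_family_on_def)
      show "indicator (E i \<inter> B n) \<in> L2_span_closure M A e" for i by (rule union(3))
      show "E i \<inter> B n \<in> sets M" for i using E B by auto
      have "emeasure M (\<Union>i. E i \<inter> B n) \<le> emeasure M (B n)"
        using B(1) by (intro emeasure_mono) auto
      then show "emeasure M (\<Union>i. E i \<inter> B n) < \<infinity>" using B(2)[of n] by (rule le_less_trans)
    qed
    then show ?case by (simp add: Int_UN_distrib2 Int_commute)
  qed
  fix E assume E: "E \<in> sets M" "emeasure M E < \<infinity>"
  have D: "disjointed B n \<in> sets M" for n using sets.range_disjointed_sets[of B M] B(1) by auto
  have UN: "(\<Union>n. E \<inter> disjointed B n) = E"
    using sets.sets_into_space[OF E(1)] cover UN_disjointed_eq[of B] by auto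
  have "indicator (\<Union>n. E \<inter> disjointed B n) \<in> L2_span_closure M A e"
  proof (rule span_closure_indicator_UN)
    show "disjoint_family (\<lambda>n. E \<inter> disjointed B n)"
      using disjoint_family_disjointed[of B] by (auto simp: disjoint_family_on_def)
    show "indicator (E \<inter> disjointed B n) \<in> L2_span_closure M A e" for n
      using local[of "E \<inter> disjointed B n" n] E D disjointed_subset[of B n]
      by (simp add: Int_assoc Int_absorb2)
    show "E \<inter> disjointed B n \<in> sets M" for n using E D by auto
    show "emeasure M (\<Union>n. E \<inter> disjointed B n) < \<infinity>" using E UN by simp
  qed
  then show "indicator E \<in> L2_span_closure M A e" using UN by simp
qed

end

section \<open>Tensor products and changes of variables\<close>

definition tensor :: "('a \<Rightarrow> complex) \<Rightarrow> ('b \<Rightarrow> complex) \<Rightarrow> 'a \<times> 'b \<Rightarrow> complex" where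
  "tensor f g = (\<lambda>(x, y). f x * g y)"

lemma tensor_measurable [measurable]:
  assumes [measurable]: "f \<in> borel_measurable M" "g \<in> borel_measurable N"
  shows "tensor f g \<in> borel_measurable (M \<Otimes>\<^sub>M N)"
  unfolding tensor_def by measurable

context pair_sigma_finite
begin

lemma L2_sq_tensor:
  assumes [measurable]: "f \<in> borel_measurable M1" "g \<in> borel_measurable M2"
  shows "L2_sq (M1 \<Otimes>\<^sub>M M2) (tensor f g) = L2_sq M1 f * L2_sq M2 g"
proof -
  have "L2_sq (M1 \<Otimes>\<^sub>M M2) (tensor f g)
      = (\<integral>\<^sup>+x. \<integral>\<^sup>+y. ennreal ((cmod (f x))\<^sup>2) * ennreal ((cmod (g y))\<^sup>2) \<partial>M2 \<partial>M1)"
    unfolding L2_sq_def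
    by (subst M2.nn_integral_fst[symmetric])
      (auto simp: tensor_def norm_mult power_mult_distrib ennreal_mult intro!: nn_integral_cong)
  then show ?thesis
    by (simp add: L2_sq_def nn_integral_cmult nn_integral_multc)
qed

lemma tensor_L2:
  assumes "f \<in> L2 M1" "g \<in> L2 M2"
  shows "tensor f g \<in> L2 (M1 \<Otimes>\<^sub>M M2)"
  using assms L2_sq_tensor[of f g] tensor_measurable[of f M1 g M2]
  by (auto simp: L2_iff_L2_sq_finite ennreal_mult_less_top)

lemma integral_tensor:
  assumes f: "integrable M1 f" and g: "integrable M2 g"
  shows "(LINT z|(M1 \<Otimes>\<^sub>M M2). tensor f g z) = (LINT x|M1. f x) * (LINT y|M2. g y)"
proof -
  have "integrable (M1 \<Otimes>\<^sub>M M2) (tensor f g)"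
  proof (rule Fubini_integrable)
    show "tensor f g \<in> borel_measurable (M1 \<Otimes>\<^sub>M M2)"
      using f g by (intro tensor_measurable borel_measurable_integrable)
    show "integrable M1 (\<lambda>x. LINT y|M2. norm (tensor f g (x, y)))"
      using f by (simp add: tensor_def norm_mult)
    show "AE x in M1. integrable M2 (\<lambda>y. tensor f g (x, y))"
      using g by (simp add: tensor_def)
  qed
  from integral_fst'[OF this] show ?thesis by (simp add: tensor_def)
qed

lemma L2_inner_tensor:
  assumes "f \<in> L2 M1" "f' \<in> L2 M1" "g \<in> L2 M2" "g' \<in> L2 M2"
  shows "L2_inner (M1 \<Otimes>\<^sub>M M2) (tensor f g) (tensor f' g') = L2_inner M1 f f' * L2_inner M2 g g'"
proof -
  have "(\<lambda>z. tensor f g z * cnj (tensor f' g' z)) = tensor (\<lambda>x. f x * cnj (f' x)) (\<lambda>y. g y * cnj (g' y))"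
    by (auto simp: tensor_def fun_eq_iff ac_simps)
  then show ?thesis
    unfolding L2_inner_def using assms by (simp add: integral_tensor integrable_L2_mult_cnj)
qed

text \<open>
The two factors are replaced by finite combinations one after the other: first \<open>g\<close> with \<open>e i\<close>
fixed, then \<open>f\<close> with \<open>g\<close> fixed. Each step multiplies the squared error by a fixed finite
squared norm.
\<close>
lemma tensor_span_closure:
  assumes e: "\<And>i. i \<in> A \<Longrightarrow> e i \<in> L2 M1" and d: "\<And>j. j \<in> B \<Longrightarrow> d j \<in> L2 M2"
    and f: "f \<in> L2_span_closure M1 A e" and g: "g \<in> L2_span_closure M2 B d" "g \<in> L2 M2"
  shows "tensor f g \<in> L2_span_closure (M1 \<Otimes>\<^sub>M M2) (A \<times> B) (\<lambda>(i, j). tensor (e i) (d j))"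
    (is "_ \<in> ?C")
proof -
  have me: "e i \<in> borel_measurable M1" if "i \<in> A" for i using e[OF that] by (simp add: L2_def)
  have md: "d j \<in> borel_measurable M2" if "j \<in> B" for j using d[OF that] by (simp add: L2_def)
  have mp: "(case k of (i, j) \<Rightarrow> tensor (e i) (d j)) \<in> borel_measurable (M1 \<Otimes>\<^sub>M M2)"
    if "k \<in> A \<times> B" for k
    using that me md by (auto intro: tensor_measurable)
  have mf: "f \<in> borel_measurable M1" and mg: "g \<in> borel_measurable M2"
    using f g by (auto simp: L2_span_closure_def)
  have combination: "(\<lambda>z. \<Sum>k\<in>F. c k * h k z) \<in> ?C" if "\<And>k. k \<in> F \<Longrightarrow> h k \<in> ?C"
    for F :: "'k set" and c h
    using that by (intro span_closure_sum span_closure_cmult mp)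
  have left: "tensor (e i) g \<in> ?C" if i: "i \<in> A" for i
  proof (rule span_closure_closed[OF mp])
    show "tensor (e i) g \<in> borel_measurable (M1 \<Otimes>\<^sub>M M2)" using me[OF i] mg by measurable
    fix r :: real assume "r > 0"
    moreover have "L2_sq M1 (e i) < \<infinity>" using e[OF i] by (simp add: L2_iff_L2_sq_finite)
    ultimately obtain s where s: "s > 0" "\<And>t. t < ennreal s \<Longrightarrow> L2_sq M1 (e i) * t < ennreal r"
      using ennreal_mult_arbitrarily_small by blast
    obtain F c where F: "finite F" "F \<subseteq> B" "L2_sq M2 (\<lambda>y. g y - (\<Sum>j\<in>F. c j * d j y)) < ennreal s"
      using g(1) s(1) unfolding L2_span_closure_def by blast
    have "tensor (e i) (d j) \<in> ?C" if "j \<in> F" for j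
      using span_closure_basis[of "A \<times> B" "\<lambda>(i, j). tensor (e i) (d j)", OF mp, of "(i, j)"] i that F by auto
    then have "(\<lambda>z. \<Sum>j\<in>F. c j * tensor (e i) (d j) z) \<in> ?C" by (rule combination)
    moreover have "(\<lambda>z. tensor (e i) g z - (\<Sum>j\<in>F. c j * tensor (e i) (d j) z))
        = tensor (e i) (\<lambda>y. g y - (\<Sum>j\<in>F. c j * d j y))"
      by (auto simp: tensor_def fun_eq_iff algebra_simps sum_distrib_left)
    moreover have "(\<lambda>y. g y - (\<Sum>j\<in>F. c j * d j y)) \<in> borel_measurable M2"
      using mg F md by (intro borel_measurable_diff span_measurable) auto
    ultimately show "\<exists>h\<in>?C. L2_sq (M1 \<Otimes>\<^sub>M M2) (\<lambda>z. tensor (e i) g z - h z) < ennreal r"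
      using s(2)[OF F(3)] me[OF i] by (intro bexI) (auto simp: L2_sq_tensor)
  qed
  show ?thesis
  proof (rule span_closure_closed[OF mp])
    show "tensor f g \<in> borel_measurable (M1 \<Otimes>\<^sub>M M2)" using mf mg by measurable
    fix r :: real assume "r > 0"
    moreover have "L2_sq M2 g < \<infinity>" using g by (simp add: L2_iff_L2_sq_finite)
    ultimately obtain s where s: "s > 0" "\<And>t. t < ennreal s \<Longrightarrow> L2_sq M2 g * t < ennreal r"
      using ennreal_mult_arbitrarily_small by blast
    obtain F c where F: "finite F" "F \<subseteq> A" "L2_sq M1 (\<lambda>x. f x - (\<Sum>i\<in>F. c i * e i x)) < ennreal s"
      using f s(1) unfolding L2_span_closure_def by blast
    have "(\<lambda>z. \<Sum>i\<in>F. c i * tensor (e i) g z) \<in> ?C" using F by (intro combination left) auto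
    moreover have "(\<lambda>z. tensor f g z - (\<Sum>i\<in>F. c i * tensor (e i) g z))
        = tensor (\<lambda>x. f x - (\<Sum>i\<in>F. c i * e i x)) g"
      by (auto simp: tensor_def fun_eq_iff algebra_simps sum_distrib_left)
    moreover have "(\<lambda>x. f x - (\<Sum>i\<in>F. c i * e i x)) \<in> borel_measurable M1"
      using mf F me by (intro borel_measurable_diff span_measurable) auto
    ultimately show "\<exists>h\<in>?C. L2_sq (M1 \<Otimes>\<^sub>M M2) (\<lambda>z. tensor f g z - h z) < ennreal r"
      using s(2)[OF F(3)] mg by (intro bexI) (auto simp: L2_sq_tensor mult.commute)
  qed
qed

text \<open>
Measurable rectangles form the generating \<open>\<pi>\<close>-system, and the products of two exhausting
sequences of finite measure form the cover. The indicator of a rectangle with sides of finite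
measure is a tensor product of two \<open>L\<^sup>2\<close> functions.
\<close>
proposition complete_orthonormal_basis_tensor:
  assumes e: "complete_orthonormal_basis M1 A e" and d: "complete_orthonormal_basis M2 B d"
  shows "complete_orthonormal_basis (M1 \<Otimes>\<^sub>M M2) (A \<times> B) (\<lambda>(i, j). tensor (e i) (d j))"
proof -
  let ?C = "L2_span_closure (M1 \<Otimes>\<^sub>M M2) (A \<times> B) (\<lambda>(i, j). tensor (e i) (d j))"
  have eL2: "e i \<in> L2 M1" if "i \<in> A" for i using e that by (simp add: complete_orthonormal_basis_iff)
  have dL2: "d j \<in> L2 M2" if "j \<in> B" for j using d that by (simp add: complete_orthonormal_basis_iff)
  have mp: "(case k of (i, j) \<Rightarrow> tensor (e i) (d j)) \<in> borel_measurable (M1 \<Otimes>\<^sub>M M2)"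
    if "k \<in> A \<times> B" for k
    using that eL2 dL2 by (auto intro!: tensor_measurable simp: L2_def)
  \<comment> \<open>Increasing exhaustions: then the diagonal products \<open>U n \<times> V n\<close> already cover the product space.\<close>
  obtain U where U: "range U \<subseteq> sets M1" "(\<Union>n. U n) = space M1" "\<And>n. emeasure M1 (U n) \<noteq> \<infinity>" "incseq U"
    using M1.sigma_finite_incseq by blast
  obtain V where V: "range V \<subseteq> sets M2" "(\<Union>n. V n) = space M2" "\<And>n. emeasure M2 (V n) \<noteq> \<infinity>" "incseq V"
    using M2.sigma_finite_incseq by blast
  have rectangle: "indicator (E \<times> F) \<in> ?C"
    if "E \<in> sets M1" "emeasure M1 E < \<infinity>" "F \<in> sets M2" "emeasure M2 F < \<infinity>" for E F
  proof -
    have "indicator E \<in> L2 M1" "indicator F \<in> L2 M2" using that by (auto intro: L2_indicator)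
    then have "tensor (indicator E) (indicator F) \<in> ?C"
      using e d eL2 dL2 by (intro tensor_span_closure) (auto simp: complete_orthonormal_basis_iff)
    moreover have "tensor (indicator E) (indicator F) = indicator (E \<times> F)"
      by (auto simp: tensor_def fun_eq_iff indicator_def)
    ultimately show ?thesis by simp
  qed
  have UV: "U n \<in> sets M1" "emeasure M1 (U n) < \<infinity>" "V n \<in> sets M2" "emeasure M2 (V n) < \<infinity>" for n
    using U V by (auto simp: less_top)
  have "L2 (M1 \<Otimes>\<^sub>M M2) \<subseteq> ?C"
  proof (rule L2_subset_span_closure_if_pi_system[OF mp Int_stable_pair_measure_generator])
    show "{a \<times> b |a b. a \<in> sets M1 \<and> b \<in> sets M2} \<subseteq> Pow (space (M1 \<Otimes>\<^sub>M M2))"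
      using pair_measure_closed by (simp add: space_pair_measure)
    show "sets (M1 \<Otimes>\<^sub>M M2) = sigma_sets (space (M1 \<Otimes>\<^sub>M M2)) {a \<times> b |a b. a \<in> sets M1 \<and> b \<in> sets M2}"
      by (simp add: sets_pair_measure space_pair_measure)
    show "(\<Union>n. U n \<times> V n) = space (M1 \<Otimes>\<^sub>M M2)"
    proof (intro set_eqI iffI)
      fix z assume "z \<in> space (M1 \<Otimes>\<^sub>M M2)"
      then have "fst z \<in> (\<Union>n. U n)" "snd z \<in> (\<Union>n. V n)"
        unfolding U(2) V(2) by (auto simp: space_pair_measure)
      then obtain n m where nm: "fst z \<in> U n" "snd z \<in> V m" by blast
      have "U n \<subseteq> U (max n m)" "V m \<subseteq> V (max n m)"
        using U(4) V(4) by (simp_all add: incseqD)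
      with nm have "z \<in> U (max n m) \<times> V (max n m)" by (auto simp: mem_Times_iff)
      then show "z \<in> (\<Union>n. U n \<times> V n)" by blast
    next
      fix z assume "z \<in> (\<Union>n. U n \<times> V n)"
      then show "z \<in> space (M1 \<Otimes>\<^sub>M M2)" using U(2) V(2) by (auto simp: space_pair_measure)
    qed
    show "U n \<times> V n \<in> sets (M1 \<Otimes>\<^sub>M M2)" for n using UV by auto
    show "emeasure (M1 \<Otimes>\<^sub>M M2) (U n \<times> V n) < \<infinity>" for n
      using UV by (simp add: M2.emeasure_pair_measure_Times ennreal_mult_less_top)
    show "indicator (U n \<times> V n) \<in> ?C" for n using UV by (intro rectangle)
    show "indicator (E \<inter> U n \<times> V n) \<in> ?C"
      if E: "E \<in> {a \<times> b |a b. a \<in> sets M1 \<and> b \<in> sets M2}" for E n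
    proof -
      obtain a b where ab: "E = a \<times> b" "a \<in> sets M1" "b \<in> sets M2" using E by blast
      have "emeasure M1 (a \<inter> U n) \<le> emeasure M1 (U n)" "emeasure M2 (b \<inter> V n) \<le> emeasure M2 (V n)"
        using UV by (auto intro: emeasure_mono)
      then have "emeasure M1 (a \<inter> U n) < \<infinity>" "emeasure M2 (b \<inter> V n) < \<infinity>"
        using UV(2,4)[of n] by (auto dest: le_less_trans)
      then have "indicator ((a \<inter> U n) \<times> (b \<inter> V n)) \<in> ?C" using ab UV by (intro rectangle) auto
      then show ?thesis using ab by (simp add: Times_Int_Times)
    qed
  qed
  moreover have "L2_inner (M1 \<Otimes>\<^sub>M M2) (tensor (e i) (d j)) (tensor (e i') (d j')) = (if (i, j) = (i', j') then 1 else 0)"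
    if "i \<in> A" "i' \<in> A" "j \<in> B" "j' \<in> B" for i i' j j'
  proof -
    have "L2_inner M1 (e i) (e i') = (if i = i' then 1 else 0)"
      "L2_inner M2 (d j) (d j') = (if j = j' then 1 else 0)"
      using e d that by (auto simp: complete_orthonormal_basis_iff)
    then show ?thesis using that eL2 dL2 by (simp add: L2_inner_tensor)
  qed
  ultimately show ?thesis
    unfolding complete_orthonormal_basis_iff using eL2 dL2 tensor_L2 by auto
qed

end

lemma complete_orthonormal_basis_reindex:
  assumes e: "complete_orthonormal_basis M A e" and h: "bij_betw h B A"
  shows "complete_orthonormal_basis M B (\<lambda>k. e (h k))"
  unfolding complete_orthonormal_basis_def
proof safe
  have hA: "h k \<in> A" if "k \<in> B" for k using h that by (auto simp: bij_betw_def)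
  have inj: "h k = h l \<longleftrightarrow> k = l" if "k \<in> B" "l \<in> B" for k l
    using h that by (auto simp: bij_betw_def inj_on_eq_iff)
  show "e (h k) \<in> L2 M" if "k \<in> B" for k
    using e hA[OF that] by (simp add: complete_orthonormal_basis_def)
  show "L2_inner M (e (h k)) (e (h l)) = (if k = l then 1 else 0)" if "k \<in> B" "l \<in> B" for k l
    using e hA[OF that(1)] hA[OF that(2)] inj[OF that] by (simp add: complete_orthonormal_basis_def)
  fix f and r :: real assume "f \<in> L2 M" "r > 0"
  then obtain F c where F: "finite F" "F \<subseteq> A" "L2_norm M (\<lambda>x. f x - (\<Sum>i\<in>F. c i * e i x)) < r"
    using e unfolding complete_orthonormal_basis_def by blast
  obtain G where G: "G \<subseteq> B" "F = h ` G" using F(2) h by (metis bij_betw_def subset_image_iff)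
  have "inj_on h G" using h G by (auto simp: bij_betw_def intro: inj_on_subset)
  then have "finite G" "\<And>x. (\<Sum>i\<in>F. c i * e i x) = (\<Sum>k\<in>G. c (h k) * e (h k) x)"
    using F G by (auto simp: finite_image_iff sum.reindex)
  then show "\<exists>G d. finite G \<and> G \<subseteq> B \<and> L2_norm M (\<lambda>x. f x - (\<Sum>k\<in>G. d k * e (h k) x)) < r"
    using F(3) G(1) by (intro exI[of _ G] exI[of _ "\<lambda>k. c (h k)"]) simp
qed

lemma L2_inner_comp:
  assumes T: "T \<in> measurable M M" "distr M M T = M" and f: "f \<in> borel_measurable M" "g \<in> borel_measurable M"
  shows "L2_inner M (\<lambda>x. f (T x)) (\<lambda>x. g (T x)) = L2_inner M f g"
proof -
  have "(\<lambda>x. cnj (g x)) \<in> borel_measurable M"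
    using f by (intro borel_measurable_continuous_on[of cnj]) (auto intro!: continuous_on_cnj continuous_on_id)
  then have "L2_inner (distr M M T) f g = L2_inner M (\<lambda>x. f (T x)) (\<lambda>x. g (T x))"
    unfolding L2_inner_def using T f by (subst integral_distr) auto
  then show ?thesis using T by simp
qed

lemma L2_sq_comp:
  assumes T: "T \<in> measurable M M" "distr M M T = M" and f: "f \<in> borel_measurable M"
  shows "L2_sq M (\<lambda>x. f (T x)) = L2_sq M f"
proof -
  have "L2_sq (distr M M T) f = L2_sq M (\<lambda>x. f (T x))"
    unfolding L2_sq_def using T f by (subst nn_integral_distr) auto
  then show ?thesis using T by simp
qed

lemma L2_comp:
  assumes "T \<in> measurable M M" "distr M M T = M" "f \<in> L2 M"
  shows "(\<lambda>x. f (T x)) \<in> L2 M"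
  using assms L2_sq_comp[OF assms(1,2), of f] measurable_compose[OF assms(1), of f]
  by (auto simp: L2_iff_L2_sq_finite)

text \<open>
To approximate \<open>f\<close> by combinations of \<open>e i \<circ> T\<close>, approximate \<open>f \<circ> S\<close> by combinations of \<open>e i\<close> and
compose with \<open>T\<close>, which does not change the error.
\<close>
lemma complete_orthonormal_basis_comp:
  assumes e: "complete_orthonormal_basis M A e"
    and T: "T \<in> measurable M M" "distr M M T = M"
    and S: "S \<in> measurable M M" "distr M M S = M"
    and ST: "\<And>x. x \<in> space M \<Longrightarrow> S (T x) = x"
  shows "complete_orthonormal_basis M A (\<lambda>i x. e i (T x))"
  unfolding complete_orthonormal_basis_iff
proof safe
  have eL2: "e i \<in> L2 M" if "i \<in> A" for i using e that by (simp add: complete_orthonormal_basis_iff)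
  then have em: "e i \<in> borel_measurable M" if "i \<in> A" for i using that by (auto simp: L2_def)
  show "(\<lambda>x. e i (T x)) \<in> L2 M" if "i \<in> A" for i using T eL2[OF that] by (rule L2_comp)
  show "L2_inner M (\<lambda>x. e i (T x)) (\<lambda>x. e j (T x)) = (if i = j then 1 else 0)" if "i \<in> A" "j \<in> A" for i j
    using e that em by (subst L2_inner_comp[OF T]) (auto simp: complete_orthonormal_basis_iff)
  fix f assume f: "f \<in> L2 M"
  have "(\<lambda>x. f (S x)) \<in> L2_span_closure M A e"
    using L2_comp[OF S f] e by (auto simp: complete_orthonormal_basis_iff)
  then have near: "\<exists>F c. finite F \<and> F \<subseteq> A \<and> L2_sq M (\<lambda>x. f (S x) - (\<Sum>i\<in>F. c i * e i x)) < ennreal r"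
    if "r > 0" for r using that by (simp add: L2_span_closure_def)
  have eq: "L2_sq M (\<lambda>x. f x - (\<Sum>i\<in>F. c i * e i (T x))) = L2_sq M (\<lambda>x. f (S x) - (\<Sum>i\<in>F. c i * e i x))"
    if "F \<subseteq> A" for F c
  proof -
    have "(\<lambda>x. f (S x) - (\<Sum>i\<in>F. c i * e i x)) \<in> borel_measurable M"
      using f that em L2_comp[OF S f] by (intro borel_measurable_diff span_measurable) (auto simp: L2_def)
    from L2_sq_comp[OF T this] show ?thesis using ST by (simp cong: L2_sq_cong)
  qed
  show "f \<in> L2_span_closure M A (\<lambda>i x. e i (T x))"
    unfolding L2_span_closure_def
  proof safe
    show "f \<in> borel_measurable M" using f by (simp add: L2_def)
    fix r :: real assume "r > 0"
    then obtain F c where "finite F" "F \<subseteq> A" "L2_sq M (\<lambda>x. f (S x) - (\<Sum>i\<in>F. c i * e i x)) < ennreal r"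
      using near by blast
    then show "\<exists>F c. finite F \<and> F \<subseteq> A \<and> L2_sq M (\<lambda>x. f x - (\<Sum>i\<in>F. c i * e i (T x))) < ennreal r"
      by (intro exI[of _ F] exI[of _ c]) (simp add: eq)
  qed
qed

lemma borel_measurable_completion_complexE:
  fixes f :: "'a \<Rightarrow> complex"
  assumes "f \<in> borel_measurable (completion M)"
  obtains g where "g \<in> borel_measurable M" "AE x in M. f x = g x"
proof -
  have "(\<lambda>x. Re (f x)) \<in> borel_measurable (completion M)" "(\<lambda>x. Im (f x)) \<in> borel_measurable (completion M)"
    using assms by measurable
  then obtain u v where uv: "u \<in> borel_measurable M" "AE x in M. Re (f x) = u x"
      "v \<in> borel_measurable M" "AE x in M. Im (f x) = v x"
    using completion_ex_borel_measurable_real by metis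
  have "(\<lambda>x. Complex (u x) (v x)) \<in> borel_measurable M"
    using uv by (simp add: borel_measurable_complex_iff)
  moreover have "AE x in M. f x = Complex (u x) (v x)"
    using uv(2,4) by eventually_elim (simp add: complex_eq_iff)
  ultimately show ?thesis by (rule that)
qed

text \<open>
A function measurable for the completion agrees almost everywhere with one measurable for the
original measure, and neither inner products nor distances see the difference.
\<close>
lemma complete_orthonormal_basis_completion:
  assumes e: "complete_orthonormal_basis M A e"
  shows "complete_orthonormal_basis (completion M) A e"
  unfolding complete_orthonormal_basis_iff
proof safe
  have sq: "L2_sq (completion M) f = L2_sq M f" for f by (simp add: L2_sq_def nn_integral_completion)
  have eL2: "e i \<in> L2 M" if "i \<in> A" for i using e that by (simp add: complete_orthonormal_basis_iff)
  show "e i \<in> L2 (completion M)" if "i \<in> A" for i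
    using eL2[OF that] by (auto simp: L2_iff_L2_sq_finite sq intro: measurable_completion)
  show "L2_inner (completion M) (e i) (e j) = (if i = j then 1 else 0)" if "i \<in> A" "j \<in> A" for i j
  proof -
    have "(\<lambda>x. e i x * cnj (e j x)) \<in> borel_measurable M"
      using integrable_L2_mult_cnj[OF eL2[OF that(1)] eL2[OF that(2)]]
      by (rule borel_measurable_integrable)
    then have "L2_inner (completion M) (e i) (e j) = L2_inner M (e i) (e j)"
      by (simp add: L2_inner_def integral_completion)
    then show ?thesis using e that by (simp add: complete_orthonormal_basis_iff)
  qed
  fix f assume f: "f \<in> L2 (completion M)"
  then obtain g where g: "g \<in> borel_measurable M" "AE x in M. f x = g x"
    using borel_measurable_completion_complexE by (auto simp: L2_def)
  have eq: "L2_sq M (\<lambda>x. f x - h x) = L2_sq M (\<lambda>x. g x - h x)" for h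
    unfolding L2_sq_def using g(2) by (intro nn_integral_cong_AE) auto
  have "g \<in> L2 M"
    using f g(1) eq[of "\<lambda>_. 0"] by (simp add: L2_iff_L2_sq_finite sq)
  then have "g \<in> L2_span_closure M A e" using e by (auto simp: complete_orthonormal_basis_iff)
  then show "f \<in> L2_span_closure (completion M) A e"
    using f by (simp add: L2_span_closure_def sq eq L2_def)
qed

section \<open>Dyadic cubes\<close>

definition dyadic_cube :: "int \<Rightarrow> ('m \<Rightarrow> int) \<Rightarrow> (real^'m) set" where
  "dyadic_cube k j = {x. \<forall>i. x $ i \<in> dyadic_interval k (j i)}"

lemma dyadic_cubes_eq: "dyadic_cubes = {dyadic_cube k j |k j. True}"
  by (simp add: dyadic_cubes_def dyadic_cube_def)

lemma dyadic_cube_in_dyadic_cubes [simp]: "dyadic_cube k j \<in> dyadic_cubes"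
  unfolding dyadic_cubes_eq by blast

lemma two_powi_pos [simp]: "(0::real) < 2 powi k"
  by simp

lemma two_powi_pred: "(2::real) powi k = 2 * 2 powi (k - 1)"
  by (simp add: power_int_diff)

text \<open>
Membership as an equation between floors reduces disjointness at equal scale to functionality of
the floor, and nestedness to \<open>floor_divide_real_eq_div\<close>.
\<close>
lemma mem_dyadic_interval_iff: "x \<in> dyadic_interval k j \<longleftrightarrow> \<lfloor>x / 2 powi k\<rfloor> = j"
  by (simp add: dyadic_interval_def floor_eq_iff pos_le_divide_eq pos_divide_less_eq)

lemma mem_dyadic_cube_iff: "x \<in> dyadic_cube k j \<longleftrightarrow> (\<lambda>i. \<lfloor>x $ i / 2 powi k\<rfloor>) = j"
  by (auto simp: dyadic_cube_def mem_dyadic_interval_iff fun_eq_iff)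

lemma floor_divide_two_powi_coarser:
  fixes x :: real
  shows "\<lfloor>x / 2 powi (k + int n)\<rfloor> = \<lfloor>x / 2 powi k\<rfloor> div 2 ^ n"
proof -
  have "x / 2 powi (k + int n) = (x / 2 powi k) / real_of_int (2 ^ n)"
    by (simp add: power_int_add)
  then show ?thesis by (simp only: floor_divide_real_eq_div[of "2 ^ n"] zero_le_power zero_le_numeral)
qed

text \<open>
Two points in one cube of scale \<open>k\<close> have equal floors at every coarser scale, so no coarser
cube separates them.
\<close>
lemma dyadic_cube_coarser:
  assumes "x \<in> dyadic_cube k j" "y \<in> dyadic_cube k j" "k \<le> k'"
  shows "x \<in> dyadic_cube k' j' \<longleftrightarrow> y \<in> dyadic_cube k' j'"
proof -
  obtain n where k': "k' = k + int n" using assms(3) by (metis zle_iff_zadd)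
  have "\<lfloor>x $ i / 2 powi k\<rfloor> = \<lfloor>y $ i / 2 powi k\<rfloor>" for i
    using assms(1,2) by (auto simp: mem_dyadic_cube_iff fun_eq_iff)
  then show ?thesis by (simp add: mem_dyadic_cube_iff k' floor_divide_two_powi_coarser)
qed

lemma dyadic_cube_nonempty: "\<exists>x. x \<in> dyadic_cube k j"
  by (rule exI[of _ "\<chi> i. of_int (j i) * 2 powi k"]) (simp add: mem_dyadic_cube_iff)

lemma dyadic_cube_Int:
  "dyadic_cube k j \<inter> dyadic_cube k' j' \<in> {{}, dyadic_cube k j, dyadic_cube k' j'}"
proof -
  have "dyadic_cube k j \<inter> dyadic_cube k' j' \<in> {{}, dyadic_cube k j}" if "k \<le> k'"
    for k k' and j j' :: "'a \<Rightarrow> int"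
    using dyadic_cube_coarser[OF _ _ that] by blast
  from this[of k k' j j'] this[of k' k j' j] show ?thesis
    by (cases "k \<le> k'") (auto simp: Int_commute)
qed

lemma dyadic_cube_borel [measurable]: "dyadic_cube k (j :: 'm::finite \<Rightarrow> int) \<in> sets borel"
proof -
  have "dyadic_cube k j = {x. \<forall>i. of_int (j i) * 2 powi k \<le> x $ i \<and> x $ i < (of_int (j i) + 1) * 2 powi k}"
    by (auto simp: dyadic_cube_def dyadic_interval_def)
  also have "\<dots> \<in> sets borel" by measurable
  finally show ?thesis .
qed

text \<open>
The half-open cube lies between an open and a closed box of equal volume.
\<close>
lemma emeasure_dyadic_cube:
  "emeasure lborel (dyadic_cube k (j :: 'm::finite \<Rightarrow> int)) = ennreal ((2 powi k) ^ CARD('m))"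
proof -
  define a b :: "real^'m" where "a = (\<chi> i. of_int (j i) * 2 powi k)"
    and "b = (\<chi> i. (of_int (j i) + 1) * 2 powi k)"
  have side: "(b - a) \<bullet> v = 2 powi k" if "v \<in> Basis" for v
    using that by (auto simp: Basis_vec_def inner_axis a_def b_def algebra_simps)
  have le: "a \<bullet> v \<le> b \<bullet> v" if "v \<in> Basis" for v
    using side[OF that] by (smt (verit) inner_diff_left two_powi_pos)
  have "(\<Prod>v\<in>Basis. (b - a) \<bullet> v) = (2 powi k) ^ CARD('m)"
    by (simp add: side cong: prod.cong)
  then have eq: "emeasure lborel (box a b) = ennreal ((2 powi k) ^ CARD('m))"
    "emeasure lborel (cbox a b) = ennreal ((2 powi k) ^ CARD('m))"
    using le by (simp_all add: emeasure_lborel_box emeasure_lborel_cbox)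
  have "box a b \<subseteq> dyadic_cube k j" "dyadic_cube k j \<subseteq> cbox a b"
    by (auto simp: dyadic_cube_def dyadic_interval_def mem_box_cart a_def b_def) (meson less_imp_le)+
  then have "emeasure lborel (box a b) \<le> emeasure lborel (dyadic_cube k j)"
    "emeasure lborel (dyadic_cube k j) \<le> emeasure lborel (cbox a b)"
    by (auto intro!: emeasure_mono)
  then show ?thesis using eq by (simp add: antisym)
qed

lemma measure_dyadic_cube:
  "measure lborel (dyadic_cube k (j :: 'm::finite \<Rightarrow> int)) = (2 powi k) ^ CARD('m)"
  by (simp add: measure_def emeasure_dyadic_cube)

lemma dyadic_cube_eq_iff:
  "dyadic_cube k j = dyadic_cube k' (j' :: 'm::finite \<Rightarrow> int) \<longleftrightarrow> k = k' \<and> j = j'"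
proof safe
  assume eq: "dyadic_cube k j = dyadic_cube k' j'"
  then have "((2::real) powi k) ^ CARD('m) = (2 powi k') ^ CARD('m)"
    by (metis measure_dyadic_cube)
  then have "(2::real) powi k = 2 powi k'"
    by (simp add: power_eq_iff_eq_base less_imp_le)
  then show k: "k = k'" using power_int_strict_increasing[of k k' "2::real"] power_int_strict_increasing[of k' k "2::real"]
    by (cases k k' rule: linorder_cases) auto
  obtain x where "x \<in> dyadic_cube k j" using dyadic_cube_nonempty by blast
  then show "j = j'" using eq k by (auto simp: mem_dyadic_cube_iff)
qed

lemma open_contains_dyadic_cube:
  fixes U :: "(real^'m::finite) set"
  assumes "open U" "x \<in> U"
  shows "\<exists>k j. x \<in> dyadic_cube k j \<and> dyadic_cube k j \<subseteq> U"
proof -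
  obtain r where r: "r > 0" "ball x r \<subseteq> U" using assms open_contains_ball by blast
  have "r / CARD('m) > 0" using r by simp
  then obtain n where n: "(1 / 2) ^ n < r / CARD('m)"
    using real_arch_pow_inv[of "r / CARD('m)" "1/2"] by auto
  define k where "k = - int n"
  have k: "2 powi k * real CARD('m) < r"
    using n by (simp add: k_def power_int_minus field_simps)
  define j where "j i = \<lfloor>x $ i / 2 powi k\<rfloor>" for i
  have x: "x \<in> dyadic_cube k j" by (simp add: mem_dyadic_cube_iff j_def fun_eq_iff)
  moreover have "y \<in> U" if y: "y \<in> dyadic_cube k j" for y
  proof -
    have close: "\<bar>x $ i - y $ i\<bar> \<le> 2 powi k" for i
      using x y by (auto simp: dyadic_cube_def dyadic_interval_def algebra_simps dest!: spec[of _ i])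
    have "norm (x - y) \<le> (\<Sum>i\<in>UNIV. \<bar>(x - y) $ i\<bar>)" by (rule norm_le_l1_cart)
    also have "\<dots> \<le> (\<Sum>i\<in>(UNIV::'m set). 2 powi k)" using close by (intro sum_mono) simp
    also have "\<dots> < r" using k by (simp add: mult.commute)
    finally show ?thesis using r by (auto simp: dist_norm)
  qed
  ultimately show ?thesis by blast
qed

lemma borel_eq_sigma_sets_dyadic_cubes:
  "sets borel = sigma_sets UNIV (insert {} (dyadic_cubes :: (real^'m::finite) set set))"
proof
  have "(U :: (real^'m) set) \<in> sigma_sets UNIV (insert {} dyadic_cubes)" if "open U" for U
  proof -
    let ?K = "{(k, j). dyadic_cube k j \<subseteq> U}"
    have "U = (\<Union>(k, j)\<in>?K. dyadic_cube k j)"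
      using open_contains_dyadic_cube[OF that] by fastforce
    also have "\<dots> \<in> sigma_sets UNIV (insert {} dyadic_cubes)"
      by (intro sigma_sets_UNION) (auto intro: sigma_sets.Basic simp: dyadic_cubes_eq)
    finally show ?thesis .
  qed
  then show "sets borel \<subseteq> sigma_sets UNIV (insert {} (dyadic_cubes :: (real^'m) set set))"
    unfolding sets_borel by (intro sigma_sets_mono) auto
  show "sigma_sets UNIV (insert {} (dyadic_cubes :: (real^'m) set set)) \<subseteq> sets borel"
  proof -
    have "insert {} dyadic_cubes \<subseteq> sets (borel :: (real^'m) measure)"
      by (auto simp: dyadic_cubes_eq)
    from sets.sigma_sets_subset[OF this] show ?thesis by simp
  qed
qed

section \<open>Walsh characters and the Haar wavelets of a cube\<close>

definition bits :: "('m \<Rightarrow> nat) set" where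
  "bits = {s. \<forall>i. s i \<in> {0, 1}}"

lemma bits_eq_PiE: "bits = PiE UNIV (\<lambda>_. {0, 1})"
  by (simp add: bits_def PiE_UNIV_domain Pi_def)

lemma finite_bits [simp]: "finite (bits :: ('m::finite \<Rightarrow> nat) set)"
  unfolding bits_eq_PiE by (intro finite_PiE) auto

lemma haar_signatures_eq: "haar_signatures = bits - {\<lambda>_. 0}"
  by (simp add: haar_signatures_def bits_def)

text \<open>
For \<open>a, b \<in> {0, 1}\<close> this is \<open>(-1)\<^sup>a\<^sup>b\<close>: the value of the one-dimensional profile \<open>h\<^sup>a\<close>, up to
normalization, on the left half (\<open>b = 0\<close>) or right half (\<open>b = 1\<close>) of an interval.
\<close>
definition hadamard_sign :: "nat \<Rightarrow> nat \<Rightarrow> real" where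
  "hadamard_sign a b = (if a = 0 \<or> b = 0 then 1 else -1)"

definition walsh :: "('m::finite \<Rightarrow> nat) \<Rightarrow> ('m \<Rightarrow> nat) \<Rightarrow> real" where
  "walsh a s = (\<Prod>i\<in>UNIV. hadamard_sign (a i) (s i))"

lemma walsh_commute: "walsh a s = walsh s a"
  by (simp add: walsh_def hadamard_sign_def disj_commute)

lemma walsh_zero: "walsh (\<lambda>_. 0) s = 1"
  by (simp add: walsh_def hadamard_sign_def)

text \<open>
The sum over \<open>{0, 1}\<^sup>m\<close> factors into the orthogonality relations of the rows of a 2 by 2
Hadamard matrix.
\<close>
lemma walsh_orthogonal:
  fixes a b :: "'m::finite \<Rightarrow> nat"
  assumes "a \<in> bits" "b \<in> bits"
  shows "(\<Sum>s\<in>bits. walsh a s * walsh b s) = (if a = b then 2 ^ CARD('m) else 0)"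
proof -
  have "(\<Sum>s\<in>bits. walsh a s * walsh b s)
      = (\<Prod>i\<in>UNIV. \<Sum>t\<in>{0, 1}. hadamard_sign (a i) t * hadamard_sign (b i) t)"
    unfolding bits_eq_PiE walsh_def by (subst prod_sum_PiE) (auto simp: prod.distrib)
  also have "\<dots> = (\<Prod>i\<in>(UNIV::'m set). if a i = b i then 2 else 0)"
  proof (intro prod.cong refl)
    fix i
    have "a i = 0 \<or> a i = 1" "b i = 0 \<or> b i = 1" using assms by (auto simp: bits_def)
    then show "(\<Sum>t\<in>{0, 1}. hadamard_sign (a i) t * hadamard_sign (b i) t) = (if a i = b i then 2 else 0)"
      by (auto simp: hadamard_sign_def)
  qed
  also have "\<dots> = (if a = b then 2 ^ CARD('m) else 0)"
    by (auto simp: fun_eq_iff)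
  finally show ?thesis .
qed

text \<open>
In each coordinate, \<open>s\<close> selects the left half (0) or the right half (1) of the side.
\<close>
definition child :: "('m \<Rightarrow> int) \<Rightarrow> ('m \<Rightarrow> nat) \<Rightarrow> 'm \<Rightarrow> int" where
  "child j s = (\<lambda>i. 2 * j i + int (s i))"

lemma child_inj: "child j s = child j t \<longleftrightarrow> s = t"
  by (auto simp: child_def fun_eq_iff)

text \<open>
The Haar function of signature \<open>a\<close> on the cube of scale \<open>k\<close> and index \<open>j\<close>, written as a step
function on the children of the cube; \<open>haar_dyadic_cube\<close> identifies it with the product of
one-dimensional Haar functions.
\<close>
definition wavelet :: "('m::finite \<Rightarrow> nat) \<Rightarrow> int \<Rightarrow> ('m \<Rightarrow> int) \<Rightarrow> real^'m \<Rightarrow> real" where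
  "wavelet a k j x = (\<Sum>s\<in>bits. walsh a s * indicator (dyadic_cube (k - 1) (child j s)) x)
     / sqrt ((2 powi k) ^ CARD('m))"

lemma dyadic_interval_halves:
  "left_half (dyadic_interval k j) = dyadic_interval (k - 1) (2 * j)"
  "right_half (dyadic_interval k j) = dyadic_interval (k - 1) (2 * j + 1)"
proof -
  define p :: real where "p = 2 powi (k - 1)"
  have p: "p > 0" "2 powi k = 2 * p" by (simp_all add: p_def two_powi_pred[of k])
  have K: "dyadic_interval k j = {2 * of_int j * p ..< 2 * of_int j * p + 2 * p}"
    using p by (simp add: dyadic_interval_def algebra_simps)
  have "(Inf (dyadic_interval k j) + Sup (dyadic_interval k j)) / 2 = 2 * of_int j * p + p"
    unfolding K using p by simp
  then show "left_half (dyadic_interval k j) = dyadic_interval (k - 1) (2 * j)"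
    "right_half (dyadic_interval k j) = dyadic_interval (k - 1) (2 * j + 1)"
    unfolding left_half_def right_half_def using p
    by (auto simp: K dyadic_interval_def p_def[symmetric] algebra_simps)
qed

lemma measure_dyadic_interval: "measure lebesgue (dyadic_interval k j) = 2 powi k"
  by (simp add: dyadic_interval_def algebra_simps)

lemma haar1_dyadic_interval:
  "haar1 a (dyadic_interval k j) x =
     (\<Sum>b\<in>{0, 1}. hadamard_sign a b * indicator (dyadic_interval (k - 1) (2 * j + int b)) x) / sqrt (2 powi k)"
proof -
  have K: "dyadic_interval k j = left_half (dyadic_interval k j) \<union> right_half (dyadic_interval k j)"
    "left_half (dyadic_interval k j) \<inter> right_half (dyadic_interval k j) = {}"
    by (auto simp: left_half_def right_half_def)
  have "(indicator (dyadic_interval k j) x :: real)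
      = indicator (left_half (dyadic_interval k j)) x + indicator (right_half (dyadic_interval k j)) x"
    using K by (subst K(1)) (simp add: indicator_add)
  moreover have "(2 powi k) powr (-1/2) = 1 / sqrt (2 powi k)"
    by (simp add: powr_minus_divide powr_half_sqrt)
  moreover have "(\<Sum>b\<in>{0, 1}. f b) = f 0 + f 1" for f :: "nat \<Rightarrow> real" by simp
  ultimately show ?thesis
    by (simp only:) (simp add: haar1_def measure_dyadic_interval dyadic_interval_halves hadamard_sign_def)
qed

lemma side_dyadic_cube: "side (dyadic_cube k j) i = dyadic_interval k (j i)"
proof
  show "side (dyadic_cube k j) i \<subseteq> dyadic_interval k (j i)"
    by (auto simp: side_def dyadic_cube_def)
  show "dyadic_interval k (j i) \<subseteq> side (dyadic_cube k j) i"
  proof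
    fix t assume t: "t \<in> dyadic_interval k (j i)"
    obtain x where x: "x \<in> dyadic_cube k j" using dyadic_cube_nonempty by blast
    have "(\<chi> l. if l = i then t else x $ l) \<in> dyadic_cube k j"
      using x t by (simp add: dyadic_cube_def)
    then show "t \<in> side (dyadic_cube k j) i"
      unfolding side_def by (rule rev_image_eqI) simp
  qed
qed

lemma prod_indicator_dyadic_interval:
  fixes x :: "real^'m::finite"
  shows "(\<Prod>i\<in>UNIV. indicator (dyadic_interval k (j i)) (x $ i)) = (indicator (dyadic_cube k j) x :: real)"
proof (cases "x \<in> dyadic_cube k j")
  case False
  then obtain i where "x $ i \<notin> dyadic_interval k (j i)" by (auto simp: dyadic_cube_def)
  then have "\<exists>i. indicator (dyadic_interval k (j i)) (x $ i) = (0::real)" by (auto simp: indicator_def)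
  then have "(\<Prod>i\<in>UNIV. indicator (dyadic_interval k (j i)) (x $ i)) = (0::real)" by simp
  then show ?thesis using False by simp
qed (simp add: dyadic_cube_def)

text \<open>
Each one-dimensional factor is a signed sum of the indicators of two half intervals; expanding
the product over the coordinates gives one term for each child.
\<close>
lemma haar_dyadic_cube:
  fixes sig :: "nat \<Rightarrow> 'm::finite \<Rightarrow> nat"
  shows "haar sig \<epsilon> (dyadic_cube k j) x = wavelet (sig \<epsilon>) k j x"
proof -
  have "(\<Prod>i\<in>UNIV. \<Sum>b\<in>{0, 1}. hadamard_sign (sig \<epsilon> i) b * indicator (dyadic_interval (k - 1) (2 * j i + int b)) (x $ i))
      = (\<Sum>s\<in>bits. walsh (sig \<epsilon>) s * indicator (dyadic_cube (k - 1) (child j s)) x)"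
    unfolding bits_eq_PiE walsh_def prod_indicator_dyadic_interval[symmetric] child_def
    by (subst prod_sum_PiE) (auto simp: prod.distrib)
  moreover have "(\<Prod>i\<in>(UNIV::'m set). sqrt (2 powi k)) = sqrt ((2 powi k) ^ CARD('m))"
    by (simp add: real_sqrt_power)
  ultimately show ?thesis
    unfolding haar_def wavelet_def side_dyadic_cube haar1_dyadic_interval prod_dividef by simp
qed

text \<open>
The same expansion with the factor \<open>h\<^sup>0\<close> in every coordinate.
\<close>
lemma indicator_dyadic_cube_children:
  fixes x :: "real^'m::finite"
  shows "(\<Sum>s\<in>bits. indicator (dyadic_cube (k - 1) (child j s)) x) = (indicator (dyadic_cube k j) x :: real)"
proof -
  have "(\<Sum>b\<in>{0, 1}. indicator (dyadic_interval (k - 1) (2 * l + int b)) t) = (indicator (dyadic_interval k l) t :: real)" for l t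
    using haar1_dyadic_interval[of 0 k l t]
    by (simp del: sum.insert sum_indicator_eq_card add: haar1_def measure_dyadic_interval hadamard_sign_def powr_minus_divide powr_half_sqrt)
  then have "(\<Prod>i\<in>UNIV. \<Sum>b\<in>{0, 1}. indicator (dyadic_interval (k - 1) (2 * j i + int b)) (x $ i))
      = (indicator (dyadic_cube k j) x :: real)"
    by (simp add: prod_indicator_dyadic_interval)
  then show ?thesis
    unfolding bits_eq_PiE prod_indicator_dyadic_interval[symmetric] child_def
    by (subst (asm) prod_sum_PiE) auto
qed

section \<open>Orthonormality and cancellation of the Haar wavelets\<close>

lemma child_disjoint:
  "indicator (dyadic_cube k (child j s)) x * indicator (dyadic_cube k (child j t)) x
    = (if s = t then indicator (dyadic_cube k (child j s)) x else (0::real))"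
  by (auto simp: indicator_def mem_dyadic_cube_iff child_inj)

lemma wavelet_outside: "x \<notin> dyadic_cube k j \<Longrightarrow> wavelet a k j x = 0"
proof -
  assume "x \<notin> dyadic_cube k j"
  then have "(\<Sum>s\<in>bits. indicator (dyadic_cube (k - 1) (child j s)) x) = (0::real)"
    by (simp add: indicator_dyadic_cube_children)
  then have "indicator (dyadic_cube (k - 1) (child j s)) x = (0::real)" if "s \<in> bits" for s
    using that by (subst (asm) sum_nonneg_eq_0_iff) auto
  then show ?thesis by (simp add: wavelet_def)
qed

text \<open>
A strictly finer cube is contained in one child or disjoint from all of them, and the wavelet
is constant on each child and outside all of them.
\<close>
lemma wavelet_constant_on_finer:
  assumes "x \<in> dyadic_cube k j" "y \<in> dyadic_cube k j" "k < k'"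
  shows "wavelet a k' j' x = wavelet a k' j' y"
  using dyadic_cube_coarser[OF assms(1,2), of "k' - 1"] assms(3)
  by (simp add: wavelet_def indicator_def)

lemma wavelet_borel [measurable]: "wavelet a k j \<in> borel_measurable borel"
  unfolding wavelet_def[abs_def] by measurable

lemma volume_children:
  "((2::real) powi k) ^ CARD('m::finite) = 2 ^ CARD('m) * (2 powi (k - 1)) ^ CARD('m)"
  by (subst two_powi_pred) (simp add: power_mult_distrib)

lemma wavelet_mult_wavelet:
  fixes x :: "real^'m::finite"
  shows "wavelet a k j x * wavelet b k j x =
    (\<Sum>s\<in>bits. walsh a s * walsh b s * indicator (dyadic_cube (k - 1) (child j s)) x) / (2 powi k) ^ CARD('m)"
proof -
  have "(\<Sum>s\<in>bits. walsh a s * indicator (dyadic_cube (k - 1) (child j s)) x)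
      * (\<Sum>t\<in>bits. walsh b t * indicator (dyadic_cube (k - 1) (child j t)) x)
      = (\<Sum>s\<in>bits. \<Sum>t\<in>bits. walsh a s * walsh b t *
         (indicator (dyadic_cube (k - 1) (child j s)) x * indicator (dyadic_cube (k - 1) (child j t)) x))"
    unfolding sum_product by (intro sum.cong refl) (simp only: ac_simps)
  also have "\<dots> = (\<Sum>s\<in>bits. walsh a s * walsh b s * indicator (dyadic_cube (k - 1) (child j s)) x)"
    unfolding child_disjoint by (simp add: if_distrib sum.delta cong: if_cong)
  finally show ?thesis
    by (simp add: wavelet_def)
qed

lemma has_bochner_integral_child_sum:
  fixes j :: "'m::finite \<Rightarrow> int" and c :: "('m \<Rightarrow> nat) \<Rightarrow> real"
  shows "has_bochner_integral lborel
    (\<lambda>x. \<Sum>s\<in>bits. c s * indicator (dyadic_cube (k - 1) (child j s)) x)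
    ((\<Sum>s\<in>bits. c s) * (2 powi (k - 1)) ^ CARD('m))"
proof -
  have "has_bochner_integral lborel (indicator (dyadic_cube (k - 1) (child j s)) :: real^'m \<Rightarrow> real)
      ((2 powi (k - 1)) ^ CARD('m))" for s
    using has_bochner_integral_real_indicator[of "dyadic_cube (k - 1) (child j s)" lborel]
    by (simp add: emeasure_dyadic_cube measure_dyadic_cube)
  then show ?thesis
    unfolding sum_distrib_right
    by (intro has_bochner_integral_sum has_bochner_integral_mult_right) auto
qed

text \<open>
The integral is proportional to the scalar product of the Walsh character \<open>a\<close> with the trivial
one.
\<close>
lemma has_bochner_integral_wavelet:
  fixes j :: "'m::finite \<Rightarrow> int"
  assumes "a \<in> haar_signatures"
  shows "has_bochner_integral lborel (wavelet a k j) 0"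
proof -
  have "a \<in> bits" "a \<noteq> (\<lambda>_. 0)" using assms by (auto simp: haar_signatures_eq)
  then have "(\<Sum>s\<in>bits. walsh a s) = 0"
    using walsh_orthogonal[of a "\<lambda>_. 0"] by (simp add: walsh_zero bits_def)
  then have "has_bochner_integral lborel
      (\<lambda>x. \<Sum>s\<in>bits. walsh a s * indicator (dyadic_cube (k - 1) (child j s)) x) 0"
    using has_bochner_integral_child_sum[of "walsh a" k j] by simp
  from has_bochner_integral_divide_zero[OF this, of "sqrt ((2 powi k) ^ CARD('m))"]
  show ?thesis by (simp add: wavelet_def[abs_def])
qed

lemma has_bochner_integral_wavelet_mult_same:
  fixes j :: "'m::finite \<Rightarrow> int"
  assumes "a \<in> bits" "b \<in> bits"
  shows "has_bochner_integral lborel (\<lambda>x. wavelet a k j x * wavelet b k j x) (if a = b then 1 else 0)"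
proof -
  have "(\<Sum>s\<in>bits. walsh a s * walsh b s) * (2 powi (k - 1)) ^ CARD('m) / (2 powi k) ^ CARD('m)
      = (if a = b then 1 else (0::real))"
    unfolding walsh_orthogonal[OF assms] volume_children[of k, where 'm='m] by simp
  then show ?thesis
    using has_bochner_integral_divide_zero[OF has_bochner_integral_child_sum[of "\<lambda>s. walsh a s * walsh b s" k j],
        of "(2 powi k) ^ CARD('m)"]
    by (simp add: wavelet_mult_wavelet)
qed

text \<open>
On the support of the finer wavelet the coarser one is constant, so only the mean 0 of the finer
one remains.
\<close>
lemma has_bochner_integral_wavelet_mult_finer:
  fixes j j' :: "'m::finite \<Rightarrow> int"
  assumes "a \<in> haar_signatures" "k < k'"
  shows "has_bochner_integral lborel (\<lambda>x. wavelet a k j x * wavelet b k' j' x) 0"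
proof -
  obtain y where y: "y \<in> dyadic_cube k j" using dyadic_cube_nonempty by blast
  have "(\<lambda>x. wavelet a k j x * wavelet b k' j' x) = (\<lambda>x. wavelet b k' j' y * wavelet a k j x)"
  proof
    fix x show "wavelet a k j x * wavelet b k' j' x = wavelet b k' j' y * wavelet a k j x"
      using wavelet_constant_on_finer[OF _ y assms(2), of x b j'] wavelet_outside[of x k j a]
      by (cases "x \<in> dyadic_cube k j") auto
  qed
  then show ?thesis
    using has_bochner_integral_mult_right[OF has_bochner_integral_wavelet[OF assms(1)], of "wavelet b k' j' y" k j]
    by simp
qed

lemma has_bochner_integral_wavelet_mult:
  fixes j j' :: "'m::finite \<Rightarrow> int"
  assumes a: "a \<in> haar_signatures" and b: "b \<in> haar_signatures"
  shows "has_bochner_integral lborel (\<lambda>x. wavelet a k j x * wavelet b k' j' x)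
    (if (k, j, a) = (k', j', b) then 1 else 0)"
proof (cases k k' rule: linorder_cases)
  case less
  then show ?thesis using has_bochner_integral_wavelet_mult_finer[OF a] by simp
next
  case greater
  then show ?thesis using has_bochner_integral_wavelet_mult_finer[OF b] by (simp add: mult.commute)
next
  case equal
  show ?thesis
  proof (cases "j = j'")
    case True
    then show ?thesis
      using equal a b has_bochner_integral_wavelet_mult_same[of a b k j] by (simp add: haar_signatures_eq)
  next
    case False
    then have "(\<lambda>x. wavelet a k j x * wavelet b k' j' x) = (\<lambda>_. 0)"
    proof (intro ext)
      fix x assume "j \<noteq> j'"
      then show "wavelet a k j x * wavelet b k' j' x = 0"
        using equal wavelet_outside[of x k j a] wavelet_outside[of x k' j' b]
        by (cases "x \<in> dyadic_cube k j"; cases "x \<in> dyadic_cube k' j'") (auto simp: mem_dyadic_cube_iff)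
    qed
    then show ?thesis using False by (simp add: has_bochner_integral_zero)
  qed
qed

section \<open>Completeness of the Haar system\<close>

text \<open>
Fourier inversion on \<open>{0, 1}\<^sup>m\<close>. The trivial character is not a Haar signature; it contributes
the multiple of the indicator of the parent cube.
\<close>
lemma indicator_child_eq_wavelets:
  fixes x :: "real^'m::finite"
  assumes s: "s \<in> bits"
  shows "indicator (dyadic_cube (k - 1) (child j s)) x =
    indicator (dyadic_cube k j) x / 2 ^ CARD('m)
    + (\<Sum>a\<in>haar_signatures. (walsh a s * sqrt ((2 powi k) ^ CARD('m)) / 2 ^ CARD('m)) * wavelet a k j x)"
proof -
  let ?q = "\<lambda>t. indicator (dyadic_cube (k - 1) (child j t)) x :: real"
  let ?v = "sqrt ((2 powi k) ^ CARD('m))"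
  have v: "?v > 0" by simp
  have "(\<Sum>a\<in>bits. walsh a s * (?v * wavelet a k j x)) = (\<Sum>a\<in>bits. \<Sum>t\<in>bits. walsh s a * walsh t a * ?q t)"
  proof (intro sum.cong refl)
    fix a :: "'m \<Rightarrow> nat"
    have "?v * wavelet a k j x = (\<Sum>t\<in>bits. walsh a t * ?q t)"
      using v by (simp only: wavelet_def) simp
    then show "walsh a s * (?v * wavelet a k j x) = (\<Sum>t\<in>bits. walsh s a * walsh t a * ?q t)"
      by (simp only: sum_distrib_left walsh_commute[of s a] walsh_commute[of _ a] mult.assoc)
  qed
  also have "\<dots> = (\<Sum>t\<in>bits. (\<Sum>a\<in>bits. walsh s a * walsh t a) * ?q t)"
    unfolding sum_distrib_right by (rule sum.swap)
  also have "\<dots> = (\<Sum>t\<in>bits. if s = t then 2 ^ CARD('m) * ?q t else 0)"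
    using s by (intro sum.cong) (auto simp: walsh_orthogonal)
  also have "\<dots> = 2 ^ CARD('m) * ?q s" using s by simp
  finally have inv: "2 ^ CARD('m) * ?q s = (\<Sum>a\<in>bits. walsh a s * (?v * wavelet a k j x))" ..
  have zero: "(\<lambda>_. 0) \<in> (bits :: ('m \<Rightarrow> nat) set)" by (simp add: bits_def)
  have "?v * wavelet (\<lambda>_. 0) k j x = indicator (dyadic_cube k j) x"
    using v by (simp add: wavelet_def walsh_zero indicator_dyadic_cube_children)
  then have "2 ^ CARD('m) * ?q s =
      indicator (dyadic_cube k j) x + (\<Sum>a\<in>haar_signatures. walsh a s * (?v * wavelet a k j x))"
    unfolding inv haar_signatures_eq by (subst sum.remove[OF finite_bits zero]) (simp add: walsh_zero)
  then have "?q s = (indicator (dyadic_cube k j) x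
      + (\<Sum>a\<in>haar_signatures. walsh a s * (?v * wavelet a k j x))) / 2 ^ CARD('m)"
    by (simp add: field_simps)
  then show ?thesis
    by (simp add: add_divide_distrib sum_divide_distrib mult.assoc)
qed

text \<open>
The floor of half the index gives the parent, the parity gives the direction of the child.
\<close>
lemma exists_parent:
  obtains j' and s :: "'m::finite \<Rightarrow> nat" where "s \<in> bits" "j = child j' s"
proof
  show "(\<lambda>i. nat (j i mod 2)) \<in> bits" by (auto simp: bits_def)
  show "j = child (\<lambda>i. j i div 2) (\<lambda>i. nat (j i mod 2))"
    by (simp add: child_def fun_eq_iff)
qed

context
  fixes W :: "(real^'m::finite \<Rightarrow> complex) set"
    and A :: "'i set" and e :: "'i \<Rightarrow> real^'m \<Rightarrow> complex"
  defines "W \<equiv> L2_span_closure lborel A e"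
  assumes e_measurable: "\<And>i. i \<in> A \<Longrightarrow> e i \<in> borel_measurable lborel"
    and wavelet_in: "\<And>a k j. a \<in> haar_signatures \<Longrightarrow> (\<lambda>x. complex_of_real (wavelet a k j x)) \<in> W"
begin

lemma indicator_minus_parent:
  obtains j' where "(\<lambda>x. indicator (dyadic_cube k j) x - indicator (dyadic_cube (k + 1) j') x / 2 ^ CARD('m)) \<in> W"
proof -
  obtain j' s where s: "s \<in> bits" "j = child j' s" by (rule exists_parent)
  have eq: "complex_of_real (indicator (dyadic_cube k j) x) - indicator (dyadic_cube (k + 1) j') x / 2 ^ CARD('m)
      = (\<Sum>a\<in>haar_signatures. complex_of_real (walsh a s * sqrt ((2 powi (k + 1)) ^ CARD('m)) / 2 ^ CARD('m))
          * complex_of_real (wavelet a (k + 1) j' x))" for x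
    using indicator_child_eq_wavelets[OF s(1), of "k + 1" j' x, THEN arg_cong[where f=complex_of_real]]
    unfolding s(2) by (simp add: of_real_indicator)
  have "(\<lambda>x. \<Sum>a\<in>haar_signatures. complex_of_real (walsh a s * sqrt ((2 powi (k + 1)) ^ CARD('m)) / 2 ^ CARD('m))
          * complex_of_real (wavelet a (k + 1) j' x)) \<in> W"
    unfolding W_def
    by (intro span_closure_sum[OF e_measurable] span_closure_cmult[OF e_measurable] wavelet_in[unfolded W_def])
  then show ?thesis
    unfolding eq[symmetric] of_real_indicator by (rule that)
qed

text \<open>
Telescoping \<open>indicator_minus_parent\<close> along \<open>n\<close> generations.
\<close>
lemma indicator_minus_ancestor:
  "\<exists>j'. (\<lambda>x. indicator (dyadic_cube k j) x - indicator (dyadic_cube (k + int n) j') x / (2 ^ CARD('m)) ^ n) \<in> W"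
proof (induction n)
  case 0
  show ?case using span_closure_zero[OF e_measurable] by (intro exI[of _ j]) (simp add: W_def)
next
  case (Suc n)
  then obtain j' where 1: "(\<lambda>x. indicator (dyadic_cube k j) x - indicator (dyadic_cube (k + int n) j') x / (2 ^ CARD('m)) ^ n) \<in> W"
    by blast
  obtain j'' where 2: "(\<lambda>x. indicator (dyadic_cube (k + int n) j') x - indicator (dyadic_cube (k + int n + 1) j'') x / 2 ^ CARD('m)) \<in> W"
    by (rule indicator_minus_parent)
  have "(\<lambda>x. (indicator (dyadic_cube k j) x - indicator (dyadic_cube (k + int n) j') x / (2 ^ CARD('m)) ^ n)
      + (1 / (2 ^ CARD('m)) ^ n) *
        (indicator (dyadic_cube (k + int n) j') x - indicator (dyadic_cube (k + int n + 1) j'') x / 2 ^ CARD('m))) \<in> W"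
    using 1 2 unfolding W_def
    by (intro span_closure_add[OF e_measurable] span_closure_cmult[OF e_measurable])
  then show ?case
    by (intro exI[of _ j'']) (simp add: field_simps)
qed

text \<open>
The ancestor \<open>n\<close> generations up has \<open>2\<^sup>m\<^sup>n\<close> times the volume, but its indicator carries the
coefficient \<open>2\<^sup>-\<^sup>m\<^sup>n\<close>, which is squared in the norm.
\<close>
lemma indicator_dyadic_cube_in_closure: "indicator (dyadic_cube k j) \<in> W"
  unfolding W_def
proof (rule span_closure_closed[OF e_measurable])
  show "indicator (dyadic_cube k j) \<in> borel_measurable lborel" by measurable
  fix r :: real assume r: "r > 0"
  define v where "v = ((2::real) powi k) ^ CARD('m)"
  have v: "v > 0" by (simp add: v_def)
  then have "r / v > 0" using r by simp
  then obtain n where n: "(1 / 2 ^ CARD('m)) ^ n < r / v"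
    using real_arch_pow_inv[of "r / v" "1 / 2 ^ CARD('m)"] by (auto simp: one_less_power)
  obtain j' where j': "(\<lambda>x. indicator (dyadic_cube k j) x - indicator (dyadic_cube (k + int n) j') x / (2 ^ CARD('m)) ^ n) \<in> W"
    using indicator_minus_ancestor by blast
  define q :: complex where "q = 1 / (2 ^ CARD('m)) ^ n"
  have vol: "((2::real) powi (k + int n)) ^ CARD('m) = v * (2 ^ CARD('m)) ^ n"
    by (simp add: v_def power_int_add power_mult_distrib power_mult[symmetric] mult.commute)
  have "L2_sq lborel (indicator (dyadic_cube (k + int n) j') :: real^'m \<Rightarrow> complex)
      = (\<integral>\<^sup>+x. indicator (dyadic_cube (k + int n) j') x \<partial>lborel)"
    unfolding L2_sq_def by (intro nn_integral_cong) (auto simp: indicator_def)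
  then have "L2_sq lborel (indicator (dyadic_cube (k + int n) j') :: real^'m \<Rightarrow> complex)
      = ennreal (v * (2 ^ CARD('m)) ^ n)"
    by (simp add: emeasure_dyadic_cube vol)
  then have "L2_sq lborel (\<lambda>x. q * indicator (dyadic_cube (k + int n) j') x)
      = ennreal ((cmod q)\<^sup>2 * (v * (2 ^ CARD('m)) ^ n))"
    using v by (subst L2_sq_cmult) (auto simp: ennreal_mult)
  also have "(cmod q)\<^sup>2 * (v * (2 ^ CARD('m)) ^ n) = v * (1 / 2 ^ CARD('m)) ^ n"
    by (simp add: q_def norm_divide norm_power power2_eq_square field_simps)
  also have "ennreal \<dots> < ennreal r"
    using n v r by (simp add: ennreal_less_iff field_simps)
  finally have "L2_sq lborel (\<lambda>x. indicator (dyadic_cube k j) x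
      - (indicator (dyadic_cube k j) x - indicator (dyadic_cube (k + int n) j') x / (2 ^ CARD('m)) ^ n)) < ennreal r"
    by (simp add: q_def)
  then show "\<exists>g\<in>L2_span_closure lborel A e. L2_sq lborel (\<lambda>x. indicator (dyadic_cube k j) x - g x) < ennreal r"
    by (rule bexI[OF _ j'[unfolded W_def]])
qed

text \<open>
Dyadic cubes with the empty set form a \<open>\<pi>\<close>-system, and the cubes of side 1 are a countable
cover.
\<close>
lemma wavelets_dense: "L2 lborel \<subseteq> W"
  unfolding W_def
proof (rule L2_subset_span_closure_if_pi_system[OF e_measurable])
  let ?G = "insert {} (dyadic_cubes :: (real^'m) set set)"
  let ?B = "\<lambda>n. dyadic_cube 0 (from_nat n :: 'm \<Rightarrow> int)"
  have Int: "E \<inter> F \<in> ?G" if EF: "E \<in> ?G" "F \<in> ?G" for E F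
  proof (cases "E = {} \<or> F = {}")
    case False
    then obtain k j k' j' where "E = dyadic_cube k j" "F = dyadic_cube k' j'"
      using EF by (auto simp: dyadic_cubes_eq)
    then show ?thesis using dyadic_cube_Int[of k j k' j'] by auto
  qed auto
  have ind: "indicator E \<in> L2_span_closure lborel A e" if "E \<in> ?G" for E
  proof (cases "E = {}")
    case True
    then have "indicator E = (\<lambda>_. 0 :: complex)" by (simp add: fun_eq_iff)
    then show ?thesis using span_closure_zero[where A=A and e=e, OF e_measurable] by simp
  next
    case False
    then show ?thesis
      using that indicator_dyadic_cube_in_closure by (auto simp: dyadic_cubes_eq W_def)
  qed
  have B: "?B n \<in> ?G" for n by simp
  show "Int_stable ?G" using Int by (simp add: Int_stable_def)
  show "sets lborel = sigma_sets (space lborel) ?G"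
    by (simp add: borel_eq_sigma_sets_dyadic_cubes)
  \<comment> \<open>\<open>from_nat\<close> enumerates the index functions, which form a countable type.\<close>
  show "(\<Union>n. ?B n) = space lborel"
  proof -
    have "x \<in> ?B (to_nat (\<lambda>i. \<lfloor>x $ i / 2 powi 0\<rfloor>))" for x
      by (simp add: mem_dyadic_cube_iff)
    then have "(\<Union>n. ?B n) = UNIV" by blast
    then show ?thesis by simp
  qed
  show "?B n \<in> sets lborel" "emeasure lborel (?B n) < \<infinity>" for n by (simp_all add: emeasure_dyadic_cube)
  show "indicator (?B n) \<in> L2_span_closure lborel A e" for n using ind B by blast
  show "indicator (E \<inter> ?B n) \<in> L2_span_closure lborel A e" if "E \<in> ?G" for E n
    using ind Int that B by blast
qed auto

end

proposition complete_orthonormal_basis_haar: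
  fixes sig :: "nat \<Rightarrow> 'm::finite \<Rightarrow> nat"
  assumes "haar_enumeration sig"
  shows "complete_orthonormal_basis lborel (dyadic_cubes \<times> haar_indices TYPE('m))
    (\<lambda>(I, \<epsilon>) x. complex_of_real (haar sig \<epsilon> I x))"
  (is "complete_orthonormal_basis _ ?A ?e")
proof -
  have sig: "bij_betw sig (haar_indices TYPE('m)) haar_signatures"
    using assms by (simp add: haar_enumeration_def)
  have e: "?e (dyadic_cube k j, \<epsilon>) = (\<lambda>x. complex_of_real (wavelet (sig \<epsilon>) k j x))" for k j \<epsilon>
    by (simp add: haar_dyadic_cube)
  have A: "\<exists>k j \<epsilon>. i = (dyadic_cube k j, \<epsilon>) \<and> \<epsilon> \<in> haar_indices TYPE('m) \<and> sig \<epsilon> \<in> haar_signatures"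
    if "i \<in> ?A" for i
  proof -
    have i: "fst i \<in> dyadic_cubes" "snd i \<in> haar_indices TYPE('m)" using that by auto
    then obtain k j where "fst i = dyadic_cube k j" by (auto simp: dyadic_cubes_eq)
    then show ?thesis
      using i(2) bij_betwE[OF sig]
      by (intro exI[of _ k] exI[of _ j] exI[of _ "snd i"]) (auto simp: prod_eq_iff)
  qed
  have L2: "?e i \<in> L2 lborel" if i: "i \<in> ?A" for i
  proof -
    obtain k j \<epsilon> where i: "i = (dyadic_cube k j, \<epsilon>)" "sig \<epsilon> \<in> haar_signatures" using A[OF i] by blast
    have "integrable lborel (\<lambda>x. wavelet (sig \<epsilon>) k j x * wavelet (sig \<epsilon>) k j x)"
      using has_bochner_integral_wavelet_mult[OF i(2) i(2), of k j k j] by (auto simp: has_bochner_integral_iff)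
    then show ?thesis unfolding i e by (simp add: L2_def power2_eq_square)
  qed
  have inner: "L2_inner lborel (?e i) (?e i') = (if i = i' then 1 else 0)" if i: "i \<in> ?A" "i' \<in> ?A" for i i'
  proof -
    obtain k j \<epsilon> where 1: "i = (dyadic_cube k j, \<epsilon>)" "\<epsilon> \<in> haar_indices TYPE('m)" "sig \<epsilon> \<in> haar_signatures"
      using A[OF i(1)] by blast
    obtain k' j' \<epsilon>' where 2: "i' = (dyadic_cube k' j', \<epsilon>')" "\<epsilon>' \<in> haar_indices TYPE('m)" "sig \<epsilon>' \<in> haar_signatures"
      using A[OF i(2)] by blast
    have "sig \<epsilon> = sig \<epsilon>' \<longleftrightarrow> \<epsilon> = \<epsilon>'"
      using sig 1(2) 2(2) by (auto simp: bij_betw_def inj_on_eq_iff)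
    then have iff: "i = i' \<longleftrightarrow> (k, j, sig \<epsilon>) = (k', j', sig \<epsilon>')"
      using 1 2 by (auto simp: dyadic_cube_eq_iff)
    have "L2_inner lborel (?e i) (?e i')
        = complex_of_real (LINT x|lborel. wavelet (sig \<epsilon>) k j x * wavelet (sig \<epsilon>') k' j' x)"
      unfolding L2_inner_def 1(1) 2(1) e by (simp flip: of_real_mult)
    also have "\<dots> = (if i = i' then 1 else 0)"
      using has_bochner_integral_wavelet_mult[OF 1(3) 2(3), of k j k' j'] iff
      by (simp add: has_bochner_integral_iff)
    finally show ?thesis .
  qed
  have dense: "L2 lborel \<subseteq> L2_span_closure lborel ?A ?e"
  proof (rule wavelets_dense)
    show m: "?e i \<in> borel_measurable lborel" if "i \<in> ?A" for i using L2[OF that] by (simp add: L2_def)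
    fix a :: "'m \<Rightarrow> nat" and k and j :: "'m \<Rightarrow> int" assume "a \<in> haar_signatures"
    then have "a \<in> sig ` haar_indices TYPE('m)" using sig by (simp add: bij_betw_def)
    then obtain \<epsilon> where "\<epsilon> \<in> haar_indices TYPE('m)" "sig \<epsilon> = a" by blast
    then show "(\<lambda>x. complex_of_real (wavelet a k j x)) \<in> L2_span_closure lborel ?A ?e"
      using span_closure_basis[of ?A ?e lborel, OF m, of "(dyadic_cube k j, \<epsilon>)"] e[of k j \<epsilon>] by simp
  qed
  show ?thesis unfolding complete_orthonormal_basis_iff using L2 inner dense by blast
qed

section \<open>Shears and twisted tubes\<close>

lemma nn_integral_lborel_translate:
  fixes c :: "'a::euclidean_space" and f :: "'a \<Rightarrow> ennreal"
  assumes "f \<in> borel_measurable borel"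
  shows "(\<integral>\<^sup>+x. f (x + c) \<partial>lborel) = (\<integral>\<^sup>+x. f x \<partial>lborel)"
proof -
  have "(\<integral>\<^sup>+x. f x \<partial>distr lborel borel ((+) c)) = (\<integral>\<^sup>+x. f (c + x) \<partial>lborel)"
    using assms by (intro nn_integral_distr) auto
  then show ?thesis by (simp add: lborel_distr_plus add.commute)
qed

text \<open>
Integrating the translated variable first, each inner integral is invariant under the
translation by \<open>g y\<close>. Taking \<open>g\<close> to be plus or minus the identity gives a shear or its inverse.
\<close>
lemma distr_translate_fst:
  fixes g :: "'b::euclidean_space \<Rightarrow> 'a::euclidean_space"
  assumes [measurable]: "g \<in> borel_measurable borel"
  shows "(\<lambda>(x, y). (x + g y, y)) \<in> measurable lborel lborel" (is "?T \<in> _")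
    and "distr lborel lborel (\<lambda>(x, y). (x + g y, y)) = lborel"
proof -
  show T: "?T \<in> measurable lborel lborel"
    by (simp add: borel_prod[symmetric])
  show "distr lborel lborel ?T = lborel"
  proof (rule measure_eqI)
    fix A assume "A \<in> sets (distr lborel lborel ?T)"
    then have A: "A \<in> sets (borel :: ('a \<times> 'b) measure)" by simp
    then have [measurable]: "A \<in> sets (borel \<Otimes>\<^sub>M borel)" unfolding borel_prod .
    have "emeasure (distr lborel lborel ?T) A = (\<integral>\<^sup>+z. indicator A z \<partial>distr lborel lborel ?T)"
      using A by simp
    also have "\<dots> = (\<integral>\<^sup>+z. indicator A (?T z) \<partial>(lborel \<Otimes>\<^sub>M lborel))"
      using A T by (subst nn_integral_distr) (auto simp: lborel_prod)
    also have "\<dots> = (\<integral>\<^sup>+y. \<integral>\<^sup>+x. indicator A (x + g y, y) \<partial>lborel \<partial>lborel)"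
      by (subst lborel_pair.nn_integral_snd[symmetric]) auto
    also have "\<dots> = (\<integral>\<^sup>+y. \<integral>\<^sup>+x. indicator A (x, y) \<partial>lborel \<partial>lborel)"
      by (intro nn_integral_cong nn_integral_lborel_translate[where f="\<lambda>x. indicator A (x, _)"]) measurable
    also have "\<dots> = (\<integral>\<^sup>+z. indicator A z \<partial>(lborel \<Otimes>\<^sub>M lborel))"
      by (subst lborel_pair.nn_integral_snd[symmetric]) auto
    also have "\<dots> = emeasure lborel A"
      using A by (simp add: lborel_prod)
    finally show "emeasure (distr lborel lborel ?T) A = emeasure lborel A" .
  qed simp
qed

lemma distr_translate_snd:
  fixes g :: "'a::euclidean_space \<Rightarrow> 'b::euclidean_space"
  assumes [measurable]: "g \<in> borel_measurable borel"
  shows "(\<lambda>(x, y). (x, y + g x)) \<in> measurable lborel lborel" (is "?T \<in> _")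
    and "distr lborel lborel (\<lambda>(x, y). (x, y + g x)) = lborel"
proof -
  show T: "?T \<in> measurable lborel lborel"
    by (simp add: borel_prod[symmetric])
  show "distr lborel lborel ?T = lborel"
  proof (rule measure_eqI)
    fix A assume "A \<in> sets (distr lborel lborel ?T)"
    then have A: "A \<in> sets (borel :: ('a \<times> 'b) measure)" by simp
    then have [measurable]: "A \<in> sets (borel \<Otimes>\<^sub>M borel)" unfolding borel_prod .
    have "emeasure (distr lborel lborel ?T) A = (\<integral>\<^sup>+z. indicator A z \<partial>distr lborel lborel ?T)"
      using A by simp
    also have "\<dots> = (\<integral>\<^sup>+z. indicator A (?T z) \<partial>(lborel \<Otimes>\<^sub>M lborel))"
      using A T by (subst nn_integral_distr) (auto simp: lborel_prod)
    also have "\<dots> = (\<integral>\<^sup>+x. \<integral>\<^sup>+y. indicator A (x, y + g x) \<partial>lborel \<partial>lborel)"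
      by (subst lborel.nn_integral_fst[symmetric]) auto
    also have "\<dots> = (\<integral>\<^sup>+x. \<integral>\<^sup>+y. indicator A (x, y) \<partial>lborel \<partial>lborel)"
      by (intro nn_integral_cong nn_integral_lborel_translate[where f="\<lambda>y. indicator A (_, y)"]) measurable
    also have "\<dots> = (\<integral>\<^sup>+z. indicator A z \<partial>(lborel \<Otimes>\<^sub>M lborel))"
      by (subst lborel.nn_integral_fst[symmetric]) auto
    also have "\<dots> = emeasure lborel A"
      using A by (simp add: lborel_prod)
    finally show "emeasure (distr lborel lborel ?T) A = emeasure lborel A" .
  qed simp
qed

lemma shear_eq:
  "shear2 = (\<lambda>(x, y). (x + (- y), y))" "shear3 = (\<lambda>(x, y). (x, y + (- x)))"
  by (simp_all add: shear2_def shear3_def)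

lemma shear_measure_preserving:
  fixes shear :: "'a::euclidean_space \<times> 'a \<Rightarrow> 'a \<times> 'a"
  assumes "shear = shear2 \<or> shear = shear3"
  shows "shear \<in> measurable lborel lborel" "distr lborel lborel shear = lborel"
  using assms distr_translate_fst[of "uminus :: 'a \<Rightarrow> 'a"] distr_translate_snd[of "uminus :: 'a \<Rightarrow> 'a"]
  by (auto simp: shear_eq simp del: add_uminus_conv_diff)

lemma complete_orthonormal_basis_shear:
  fixes e :: "'i \<Rightarrow> 'a::euclidean_space \<times> 'a \<Rightarrow> complex"
  assumes e: "complete_orthonormal_basis lborel A e" and shear: "shear = shear2 \<or> shear = shear3"
  shows "complete_orthonormal_basis lebesgue A (\<lambda>i x. e i (shear x))"
proof (rule complete_orthonormal_basis_completion)
  note T = shear_measure_preserving[OF shear]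
  from shear show "complete_orthonormal_basis lborel A (\<lambda>i x. e i (shear x))"
  proof
    assume "shear = shear2"
    then show ?thesis
      by (intro complete_orthonormal_basis_comp[OF e T distr_translate_fst[of "\<lambda>y. y"]])
        (auto simp: shear2_def split: prod.splits)
  next
    assume "shear = shear3"
    then show ?thesis
      by (intro complete_orthonormal_basis_comp[OF e T distr_translate_snd[of "\<lambda>x. x"]])
        (auto simp: shear3_def split: prod.splits)
  qed
qed

lemma complete_orthonormal_basis_haar_prod:
  fixes sig :: "nat \<Rightarrow> 'm::finite \<Rightarrow> nat"
  assumes "haar_enumeration sig"
  shows "complete_orthonormal_basis lborel
      (dyadic_cubes \<times> dyadic_cubes \<times> (haar_indices TYPE('m) \<times> haar_indices TYPE('m)))
      (\<lambda>(I, J, \<epsilon>) x. complex_of_real (haar_prod sig \<epsilon> I J x))"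
proof -
  let ?A = "(dyadic_cubes :: (real^'m) set set) \<times> haar_indices TYPE('m)"
  let ?e = "\<lambda>(I, \<epsilon>) x. complex_of_real (haar sig \<epsilon> I x)"
  let ?h = "\<lambda>(I, J, \<epsilon>). ((I, fst \<epsilon>), (J, snd \<epsilon>))"
  have tensor: "complete_orthonormal_basis lborel (?A \<times> ?A) (\<lambda>(i, j). tensor (?e i) (?e j))"
    using lborel_pair.complete_orthonormal_basis_tensor[OF
        complete_orthonormal_basis_haar[OF assms] complete_orthonormal_basis_haar[OF assms]]
    by (simp add: lborel_prod)
  have "bij_betw ?h (dyadic_cubes \<times> dyadic_cubes \<times> (haar_indices TYPE('m) \<times> haar_indices TYPE('m))) (?A \<times> ?A)"
    by (rule bij_betw_byWitness[where f'="\<lambda>((I, \<epsilon>1), (J, \<epsilon>2)). (I, J, (\<epsilon>1, \<epsilon>2))"]) auto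
  from complete_orthonormal_basis_reindex[OF tensor this]
  show ?thesis
    by (rule back_subst[of "complete_orthonormal_basis _ _"])
      (auto simp: fun_eq_iff tensor_def haar_prod_def)
qed

lemma has_bochner_integral_haar:
  fixes sig :: "nat \<Rightarrow> 'm::finite \<Rightarrow> nat"
  assumes sig: "haar_enumeration sig" and "I \<in> dyadic_cubes" "\<epsilon> \<in> haar_indices TYPE('m)"
  shows "has_bochner_integral lebesgue (haar sig \<epsilon> I) 0"
proof -
  obtain k j where I: "I = dyadic_cube k j" using assms(2) by (auto simp: dyadic_cubes_eq)
  have "haar sig \<epsilon> I = wavelet (sig \<epsilon>) k j" by (simp add: I haar_dyadic_cube fun_eq_iff)
  moreover have "sig \<epsilon> \<in> haar_signatures" using sig assms(3) by (auto simp: haar_enumeration_def bij_betw_def)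
  ultimately have "has_bochner_integral lborel (haar sig \<epsilon> I) 0" by (simp add: has_bochner_integral_wavelet)
  moreover have "haar sig \<epsilon> I \<in> borel_measurable lborel"
    using calculation by (auto simp: has_bochner_integral_iff)
  ultimately show ?thesis
    by (simp add: has_bochner_integral_iff integrable_completion integral_completion)
qed

lemma haar_eq_0_iff:
  assumes "I \<in> dyadic_cubes"
  shows "haar sig \<epsilon> I x = 0 \<longleftrightarrow> x \<notin> I"
proof -
  obtain k j where I: "I = dyadic_cube k j" using assms by (auto simp: dyadic_cubes_eq)
  have "haar1 a (dyadic_interval k l) t = 0 \<longleftrightarrow> t \<notin> dyadic_interval k l" for a l t
    by (auto simp: haar1_def measure_dyadic_interval left_half_def right_half_def indicator_def)
  then show ?thesis
    by (simp add: haar_def I side_dyadic_cube) (simp add: dyadic_cube_def)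
qed

lemma measure_tube:
  fixes I J :: "(real^'m::finite) set"
  assumes I: "I \<in> dyadic_cubes" and J: "J \<in> dyadic_cubes"
    and tube: "tube = tube2 I J \<or> tube = tube3 I J"
  shows "tube \<in> lmeasurable" "measure lebesgue tube = measure lebesgue I * measure lebesgue J"
proof -
  obtain shear where shear: "shear = shear2 \<or> shear = shear3" and "tube = shear -` (I \<times> J)"
    using tube by (force simp: tube2_def tube3_def shear2_def shear3_def)
  note T = shear_measure_preserving[OF shear]
  have B: "I \<in> sets borel" "J \<in> sets borel" "emeasure lborel I < \<infinity>" "emeasure lborel J < \<infinity>"
    using I J by (auto simp: dyadic_cubes_eq emeasure_dyadic_cube)
  then have IJ: "I \<times> J \<in> sets lborel" by (simp add: borel_prod[symmetric])
  then have sets: "tube \<in> sets lborel"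
    using measurable_sets[OF T(1) IJ] \<open>tube = _\<close> by simp
  have "emeasure lborel tube = emeasure (distr lborel lborel shear) (I \<times> J)"
    using T(1) IJ \<open>tube = _\<close> by (simp add: emeasure_distr)
  also have "\<dots> = emeasure lborel I * emeasure lborel J"
    unfolding T(2) unfolding lborel_prod[symmetric] using B by (simp add: lborel.emeasure_pair_measure_Times)
  finally have em: "emeasure lborel tube = emeasure lborel I * emeasure lborel J" .
  then show "tube \<in> lmeasurable"
    using sets B by (intro fmeasurableI) (auto simp: ennreal_mult_less_top)
  show "measure lebesgue tube = measure lebesgue I * measure lebesgue J"
    using sets B em by (simp add: measure_def enn2real_mult)
qed

theorem proposition2p1:
  fixes sig :: "nat \<Rightarrow> 'm::finite \<Rightarrow> nat"
  assumes "haar_enumeration sig"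
  shows "
    \<comment> \<open>(i) supports and measures\<close>
    (\<forall>I\<in>dyadic_cubes. \<forall>J\<in>dyadic_cubes. \<forall>\<epsilon>\<in>haar_indices TYPE('m) \<times> haar_indices TYPE('m).
       {x. twisted_haar2 sig \<epsilon> I J x \<noteq> 0} = tube2 I J \<and>
       {x. twisted_haar3 sig \<epsilon> I J x \<noteq> 0} = tube3 I J) \<and>
    (\<exists>c>0. \<exists>C>0. \<forall>I\<in>dyadic_cubes. \<forall>J\<in>(dyadic_cubes :: (real^'m) set set).
       tube2 I J \<in> lmeasurable \<and> tube3 I J \<in> lmeasurable \<and>
       measure lebesgue (tube2 I J) = measure lebesgue (tube3 I J) \<and>
       c * (measure lebesgue I * measure lebesgue J) \<le> measure lebesgue (tube2 I J) \<and>
       measure lebesgue (tube2 I J) \<le> C * (measure lebesgue I * measure lebesgue J)) \<and>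
    \<comment> \<open>(ii) complete orthonormal bases\<close>
    complete_orthonormal_basis lebesgue
      (dyadic_cubes \<times> dyadic_cubes \<times> (haar_indices TYPE('m) \<times> haar_indices TYPE('m)))
      (\<lambda>(I, J, \<epsilon>) x. complex_of_real (twisted_haar2 sig \<epsilon> I J x)) \<and>
    complete_orthonormal_basis lebesgue
      (dyadic_cubes \<times> dyadic_cubes \<times> (haar_indices TYPE('m) \<times> haar_indices TYPE('m)))
      (\<lambda>(I, J, \<epsilon>) x. complex_of_real (twisted_haar3 sig \<epsilon> I J x)) \<and>
    \<comment> \<open>(iii) cancellation; (x1, x2) = (u + v, v) for the first system and (u, u + v) for the second\<close>
    (\<forall>I\<in>dyadic_cubes. \<forall>J\<in>dyadic_cubes.
     \<forall>\<epsilon>1\<in>haar_indices TYPE('m). \<forall>\<epsilon>2\<in>haar_indices TYPE('m).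
       (\<forall>x1 x2. twisted_haar2 sig (\<epsilon>1, \<epsilon>2) I J (x1, x2)
                  = haar sig \<epsilon>1 I (x1 - x2) * haar sig \<epsilon>2 J x2) \<and>
       (\<forall>x1 x2. twisted_haar3 sig (\<epsilon>1, \<epsilon>2) I J (x1, x2)
                  = haar sig \<epsilon>1 I x1 * haar sig \<epsilon>2 J (x2 - x1)) \<and>
       (\<forall>v. has_bochner_integral lebesgue (\<lambda>u. twisted_haar2 sig (\<epsilon>1, \<epsilon>2) I J (u + v, v)) 0) \<and>
       (\<forall>u. has_bochner_integral lebesgue (\<lambda>v. twisted_haar2 sig (\<epsilon>1, \<epsilon>2) I J (u + v, v)) 0) \<and>
       (\<forall>v. has_bochner_integral lebesgue (\<lambda>u. twisted_haar3 sig (\<epsilon>1, \<epsilon>2) I J (u, u + v)) 0) \<and>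
       (\<forall>u. has_bochner_integral lebesgue (\<lambda>v. twisted_haar3 sig (\<epsilon>1, \<epsilon>2) I J (u, u + v)) 0))"
proof (intro conjI)
  show "\<forall>I\<in>dyadic_cubes. \<forall>J\<in>dyadic_cubes. \<forall>\<epsilon>\<in>haar_indices TYPE('m) \<times> haar_indices TYPE('m).
       {x. twisted_haar2 sig \<epsilon> I J x \<noteq> 0} = tube2 I J \<and>
       {x. twisted_haar3 sig \<epsilon> I J x \<noteq> 0} = tube3 I J"
    by (auto simp: haar_eq_0_iff twisted_haar2_def twisted_haar3_def haar_prod_def shear2_def shear3_def
        tube2_def tube3_def)
  show "\<exists>c>0. \<exists>C>0. \<forall>I\<in>dyadic_cubes. \<forall>J\<in>(dyadic_cubes :: (real^'m) set set).
       tube2 I J \<in> lmeasurable \<and> tube3 I J \<in> lmeasurable \<and>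
       measure lebesgue (tube2 I J) = measure lebesgue (tube3 I J) \<and>
       c * (measure lebesgue I * measure lebesgue J) \<le> measure lebesgue (tube2 I J) \<and>
       measure lebesgue (tube2 I J) \<le> C * (measure lebesgue I * measure lebesgue J)"
    by (intro exI[of _ 1] conjI ballI) (simp_all add: measure_tube)
  have "complete_orthonormal_basis lebesgue
      (dyadic_cubes \<times> dyadic_cubes \<times> (haar_indices TYPE('m) \<times> haar_indices TYPE('m)))
      (\<lambda>i x. (case i of (I, J, \<epsilon>) \<Rightarrow> \<lambda>x. complex_of_real (haar_prod sig \<epsilon> I J x)) (shear x))"
    if "shear = shear2 \<or> shear = shear3" for shear
    by (rule complete_orthonormal_basis_shear[OF complete_orthonormal_basis_haar_prod[OF assms] that])
  note basis = this[of shear2] this[of shear3]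
  show "complete_orthonormal_basis lebesgue
      (dyadic_cubes \<times> dyadic_cubes \<times> (haar_indices TYPE('m) \<times> haar_indices TYPE('m)))
      (\<lambda>(I, J, \<epsilon>) x. complex_of_real (twisted_haar2 sig \<epsilon> I J x))"
    using basis(1) by (simp add: twisted_haar2_def case_prod_unfold)
  show "complete_orthonormal_basis lebesgue
      (dyadic_cubes \<times> dyadic_cubes \<times> (haar_indices TYPE('m) \<times> haar_indices TYPE('m)))
      (\<lambda>(I, J, \<epsilon>) x. complex_of_real (twisted_haar3 sig \<epsilon> I J x))"
    using basis(2) by (simp add: twisted_haar3_def case_prod_unfold)
next
  have prod2: "twisted_haar2 sig (\<epsilon>1, \<epsilon>2) I J (x1, x2) = haar sig \<epsilon>1 I (x1 - x2) * haar sig \<epsilon>2 J x2"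
    and prod3: "twisted_haar3 sig (\<epsilon>1, \<epsilon>2) I J (x1, x2) = haar sig \<epsilon>1 I x1 * haar sig \<epsilon>2 J (x2 - x1)"
    for \<epsilon>1 \<epsilon>2 I J x1 x2
    by (simp_all add: twisted_haar2_def twisted_haar3_def haar_prod_def shear2_def shear3_def)
  have left: "has_bochner_integral lebesgue (\<lambda>u. haar sig \<epsilon> I u * c) 0"
    and right: "has_bochner_integral lebesgue (\<lambda>v. c * haar sig \<epsilon> I v) 0"
    if "I \<in> dyadic_cubes" "\<epsilon> \<in> haar_indices TYPE('m)" for I \<epsilon> c
    using has_bochner_integral_mult_left[OF has_bochner_integral_haar[OF assms that], of c]
      has_bochner_integral_mult_right[OF has_bochner_integral_haar[OF assms that], of c] by simp_all
  show "\<forall>I\<in>dyadic_cubes. \<forall>J\<in>dyadic_cubes.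
     \<forall>\<epsilon>1\<in>haar_indices TYPE('m). \<forall>\<epsilon>2\<in>haar_indices TYPE('m).
       (\<forall>x1 x2. twisted_haar2 sig (\<epsilon>1, \<epsilon>2) I J (x1, x2)
                  = haar sig \<epsilon>1 I (x1 - x2) * haar sig \<epsilon>2 J x2) \<and>
       (\<forall>x1 x2. twisted_haar3 sig (\<epsilon>1, \<epsilon>2) I J (x1, x2)
                  = haar sig \<epsilon>1 I x1 * haar sig \<epsilon>2 J (x2 - x1)) \<and>
       (\<forall>v. has_bochner_integral lebesgue (\<lambda>u. twisted_haar2 sig (\<epsilon>1, \<epsilon>2) I J (u + v, v)) 0) \<and>
       (\<forall>u. has_bochner_integral lebesgue (\<lambda>v. twisted_haar2 sig (\<epsilon>1, \<epsilon>2) I J (u + v, v)) 0) \<and>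
       (\<forall>v. has_bochner_integral lebesgue (\<lambda>u. twisted_haar3 sig (\<epsilon>1, \<epsilon>2) I J (u, u + v)) 0) \<and>
       (\<forall>u. has_bochner_integral lebesgue (\<lambda>v. twisted_haar3 sig (\<epsilon>1, \<epsilon>2) I J (u, u + v)) 0)"
    by (simp add: prod2 prod3 left right)
qed

end
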